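(* Let $\varphi$ be a non-constant entire function of exponential type and let $\alpha\in\mathbb{C}$ be such that $|\varphi(\alpha)|=1$ and $\varphi'(\alpha)\neq0$. Then for every function $q:[0,\infty)\to[1,\infty)$ with $q(r)\to\infty$ as $r\to\infty$, there is an entire function $f_0$ with $M_{f_0}(r)=O(r^{q(r)})$ (as $r\to\infty$) such that $f_0e_\alpha\in\mathcal{HC}(\varphi(D),H(\mathbb{C}))$.
   Context: $H(\mathbb{C})$ is the space of entire functions with the topology of locally uniform convergence; $M_f(r)=\max_{|z|=r}|f(z)|$; $e_\alpha$ denotes the function $z\mapsto e^{\alpha z}$. An entire function $f$ is of exponential type if $\limsup_{r\to\infty}\frac{\log M_f(r)}{r}<+\infty$. For an entire function $\varphi(z)=\sum_{n\ge 0}c_nz^n$ of exponential type, $\varphi(D):H(\mathbb{C})\to H(\mathbb{C})$ is the continuous linear operator $\varphi(D)f=\sum_{n\ge0}c_nf^{(n)}$. For a continuous linear operator $T:X\to X$ on a topological vector space $X$, $\mathcal{HC}(T,X)$ is the set of hypercyclic vectors, i.e. of all $x\in X$ such that $\{T^nx:n\in\mathbb{N}\}$ is dense in $X$. *)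

theory Defs
  imports "HOL-Complex_Analysis.Complex_Analysis" "HOL-Library.Landau_Symbols"
begin

definition entire :: "(complex \<Rightarrow> complex) set" where
  "entire = {f. f holomorphic_on UNIV}"

text \<open>The space \<open>H(\<complex>)\<close>: its carrier is \<^const>\<open>entire\<close>, and a basis of neighbourhoods of \<open>f\<close> is
  given by the sets of entire functions that are uniformly \<open>\<epsilon>\<close>-close to \<open>f\<close> on a compact set.
  Since \<open>\<complex>\<close> is locally compact, this is the topology of locally uniform convergence.\<close>

definition entire_topology :: "(complex \<Rightarrow> complex) topology" where
  "entire_topology = topology (\<lambda>U. U \<subseteq> entire \<and>
     (\<forall>f\<in>U. \<exists>K \<epsilon>. compact K \<and> \<epsilon> > 0 \<and>
        {g \<in> entire. \<forall>z\<in>K. dist (g z) (f z) < \<epsilon>} \<subseteq> U))"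

lemma openin_entire_topology:
  "openin entire_topology U \<longleftrightarrow> U \<subseteq> entire \<and>
     (\<forall>f\<in>U. \<exists>K \<epsilon>. compact K \<and> \<epsilon> > 0 \<and>
        {g \<in> entire. \<forall>z\<in>K. dist (g z) (f z) < \<epsilon>} \<subseteq> U)"
proof -
  let ?P = "\<lambda>U f. \<exists>K \<epsilon>. compact K \<and> (\<epsilon>::real) > 0 \<and>
        {g \<in> entire. \<forall>z\<in>K. dist (g z) (f z) < \<epsilon>} \<subseteq> U"
  have inter: "?P (S \<inter> T) f" if S: "?P S f" and T: "?P T f" for S T f
  proof -
    from S obtain K1 e1 where 1: "compact K1" "e1 > 0"
      "{g \<in> entire. \<forall>z\<in>K1. dist (g z) (f z) < e1} \<subseteq> S" by blast
    from T obtain K2 e2 where 2: "compact K2" "e2 > 0"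
      "{g \<in> entire. \<forall>z\<in>K2. dist (g z) (f z) < e2} \<subseteq> T" by blast
    have "{g \<in> entire. \<forall>z\<in>K1 \<union> K2. dist (g z) (f z) < min e1 e2} \<subseteq> S \<inter> T"
      using 1(3) 2(3) by auto
    moreover have "compact (K1 \<union> K2)" "min e1 e2 > 0"
      using 1 2 by auto
    ultimately show ?thesis by blast
  qed
  have union: "?P (\<Union>\<K>) f" if "S \<in> \<K>" "?P S f" for \<K> S f
  proof -
    from that(2) obtain K e where "compact K" "e > 0"
      "{g \<in> entire. \<forall>z\<in>K. dist (g z) (f z) < e} \<subseteq> S" by blast
    moreover from this(3) that(1)
    have "{g \<in> entire. \<forall>z\<in>K. dist (g z) (f z) < e} \<subseteq> \<Union>\<K>" by (meson Sup_upper order_trans)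
    ultimately show ?thesis by blast
  qed
  have "istopology (\<lambda>U. U \<subseteq> entire \<and> (\<forall>f\<in>U. ?P U f))"
    unfolding istopology_def
  proof (intro conjI allI impI ballI)
    fix S T
    assume S: "S \<subseteq> entire \<and> (\<forall>f\<in>S. ?P S f)" and T: "T \<subseteq> entire \<and> (\<forall>f\<in>T. ?P T f)"
    show "S \<inter> T \<subseteq> entire" using S by (simp add: le_infI1)
    fix f assume "f \<in> S \<inter> T"
    then show "?P (S \<inter> T) f"
      by (intro inter bspec[OF conjunct2[OF S]] bspec[OF conjunct2[OF T]]) simp_all
  next
    fix \<K>
    assume A: "\<forall>S\<in>\<K>. S \<subseteq> entire \<and> (\<forall>f\<in>S. ?P S f)"
    show "\<Union>\<K> \<subseteq> entire" by (rule Sup_least) (rule conjunct1[OF bspec[OF A]])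
    fix f assume "f \<in> \<Union>\<K>"
    then obtain S where S: "S \<in> \<K>" "f \<in> S" by (rule UnionE)
    show "?P (\<Union>\<K>) f"
      by (rule union[OF S(1)]) (rule bspec[OF conjunct2[OF bspec[OF A S(1)]] S(2)])
  qed
  then show ?thesis
    unfolding entire_topology_def by (simp add: topology_inverse')
qed

lemma topspace_entire_topology [simp]: "topspace entire_topology = entire"
proof -
  have "openin entire_topology entire"
    unfolding openin_entire_topology by (auto intro!: exI[of _ "{}"] exI[of _ "1::real"])
  then show ?thesis
    by (meson openin_entire_topology openin_subset openin_topspace subset_antisym)
qed

text \<open>For continuous \<open>f\<close> and \<open>r \<ge> 0\<close> the supremum is a maximum.\<close>

definition max_modulus :: "(complex \<Rightarrow> complex) \<Rightarrow> real \<Rightarrow> real" where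
  "max_modulus f r = (SUP z\<in>sphere 0 r. norm (f z))"

lemma max_modulus_attained:
  assumes "f \<in> entire" "r \<ge> 0"
  shows "\<exists>z\<in>sphere 0 r. max_modulus f r = norm (f z)"
    and "z \<in> sphere 0 r \<Longrightarrow> norm (f z) \<le> max_modulus f r"
proof -
  have cont: "continuous_on (sphere 0 r) (\<lambda>z. norm (f z))"
    using assms(1) unfolding entire_def
    by (auto intro!: continuous_on_norm
          dest: holomorphic_on_imp_continuous_on intro: continuous_on_subset)
  have ne: "sphere (0::complex) r \<noteq> {}"
    using assms(2) by simp
  obtain w where w: "w \<in> sphere 0 r" "\<And>z. z \<in> sphere 0 r \<Longrightarrow> norm (f z) \<le> norm (f w)"
    using continuous_attains_sup[OF compact_sphere ne cont] by blast
  have eq: "max_modulus f r = norm (f w)"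
    unfolding max_modulus_def using w by (intro cSup_eq_maximum) auto
  show "\<exists>z\<in>sphere 0 r. max_modulus f r = norm (f z)"
    using w(1) eq by blast
  show "norm (f z) \<le> max_modulus f r" if "z \<in> sphere 0 r"
    using w(2)[OF that] eq by simp
qed

text \<open>The convention \<open>ln 0 = 0\<close> only matters for \<open>f = 0\<close>, which is of exponential type under
  either convention.\<close>

definition exponential_type :: "(complex \<Rightarrow> complex) \<Rightarrow> bool" where
  "exponential_type f \<longleftrightarrow> f \<in> entire \<and>
     Limsup at_top (\<lambda>r. ereal (ln (max_modulus f r) / r)) < \<infinity>"

text \<open>The operator \<open>\<phi>(D)\<close>. The \<open>n\<close>-th Taylor coefficient of \<open>\<phi>\<close> at \<open>0\<close> is
  \<open>\<phi>\<^sup>(\<^sup>n\<^sup>)(0) / n!\<close>. For \<open>\<phi>\<close> of exponential type and \<open>f\<close> entire, the series converges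
  locally uniformly, so its sum in \<open>H(\<complex>)\<close> is the pointwise sum.\<close>

definition diff_op :: "(complex \<Rightarrow> complex) \<Rightarrow> (complex \<Rightarrow> complex) \<Rightarrow> complex \<Rightarrow> complex" where
  "diff_op \<phi> f = (\<lambda>z. \<Sum>n. (deriv ^^ n) \<phi> 0 / fact n * (deriv ^^ n) f z)"

definition hypercyclic_vectors :: "('a \<Rightarrow> 'a) \<Rightarrow> 'a topology \<Rightarrow> 'a set" where
  "hypercyclic_vectors T X =
     {x \<in> topspace X. X closure_of {(T ^^ n) x | n. True} = topspace X}"

definition exp_fun :: "complex \<Rightarrow> complex \<Rightarrow> complex" where
  "exp_fun \<alpha> = (\<lambda>z. exp (\<alpha> * z))"

end

theory Submission
  imports Defs
begin

text \<open>
  On the functions \<open>P e\<^sub>\<alpha>\<close> with \<open>P\<close> a polynomial, \<open>\<phi>(D)\<close> acts with the single eigenvalue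
  \<open>\<kappa> = \<phi>(\<alpha>)\<close> of modulus one, and since \<open>\<phi>'(\<alpha>) \<noteq> 0\<close> it lowers degrees by exactly one after subtracting
  \<open>\<kappa>\<close>. Hence there are polynomials \<open>b\<^sub>j\<close> of degree \<open>j\<close> with
  \<open>\<phi>(D)(b\<^sub>j e\<^sub>\<alpha>) = \<kappa> (b\<^sub>j + b\<^sub>j\<^sub>-\<^sub>1) e\<^sub>\<alpha>\<close>, and sending the binomial polynomial \<open>x gchoose j\<close> to \<open>b\<^sub>j\<close>
  turns \<open>\<phi>(D)/\<kappa>\<close> into the translation \<open>g(x) \<mapsto> g(x + 1)\<close>. For translations, two polynomials \<open>F\<close> and \<open>Q\<close>
  are joined by interpolation: with \<open>H\<close> vanishing to high order at 0 and \<open>1 - H\<close> at 1, the polynomial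
  \<open>p\<^sub>n(x) = H(x/n) (\<kappa>\<^sup>-\<^sup>n Q(x - n) - F(x))\<close> tends to 0 while \<open>(F + p\<^sub>n)(x + n) - \<kappa>\<^sup>-\<^sup>n Q(x)\<close> tends to 0 too,
  and the degrees of the \<open>p\<^sub>n\<close> stay bounded. Bounded degree and small coefficients keep the growth below
  \<open>r\<^sup>q\<^sup>(\<^sup>r\<^sup>)\<close>, so summing such corrections over a dense sequence of targets gives \<open>f\<^sub>0\<close>.
\<close>

section \<open>Differential operators of infinite order\<close>

text \<open>The coefficients are arbitrary rather than tied to a function \<open>\<phi>\<close>,
  because the commutator of such an operator with multiplication by \<open>z\<close> is again of
  this kind, with another coefficient sequence.\<close>

definition coeff_op :: "(nat \<Rightarrow> complex) \<Rightarrow> (complex \<Rightarrow> complex) \<Rightarrow> complex \<Rightarrow> complex" where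
  "coeff_op c f = (\<lambda>z. \<Sum>n. c n * (deriv ^^ n) f z)"

text \<open>Exponential type read off from Taylor coefficients: the power series with coefficients
  \<open>c\<close> is dominated by \<open>C * exp (A * |z|)\<close>.\<close>

definition exp_bounded :: "real \<Rightarrow> real \<Rightarrow> (nat \<Rightarrow> complex) \<Rightarrow> bool" where
  "exp_bounded C A c \<longleftrightarrow> C > 0 \<and> A > 0 \<and> (\<forall>n. norm (c n) \<le> C * A ^ n / fact n)"

section \<open>Taylor coefficients of a symbol of exponential type\<close>

lemma exponential_type_bound:
  assumes "exponential_type \<phi>"
  obtains a R where "a > 0" "R > 0" "\<And>z. norm z \<ge> R \<Longrightarrow> norm (\<phi> z) \<le> exp (a * norm z)"
proof -
  have ent: "\<phi> \<in> entire" and L: "Limsup at_top (\<lambda>r. ereal (ln (max_modulus \<phi> r) / r)) < \<infinity>"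
    using assms unfolding exponential_type_def by auto
  obtain b :: ereal where b: "Limsup at_top (\<lambda>r. ereal (ln (max_modulus \<phi> r) / r)) < b" "b < \<infinity>"
    using L dense by blast
  \<comment> \<open>The bound \<open>b\<close> may be a real of either sign or
    \<open>-\<infinity>\<close>; any positive real majorant serves.\<close>
  have "\<exists>a>0. b \<le> ereal a"
  proof (cases b)
    case (real r)
    then show ?thesis by (intro exI[of _ "max 1 r"]) auto
  qed (use b(2) in \<open>auto intro: exI[of _ 1]\<close>)
  then obtain a where a: "a > 0" "b \<le> ereal a" by blast
  have "eventually (\<lambda>r. ereal (ln (max_modulus \<phi> r) / r) < b) at_top"
    using Limsup_lessD[OF b(1)] .
  then obtain R0 where R0: "\<And>r. r \<ge> R0 \<Longrightarrow> ereal (ln (max_modulus \<phi> r) / r) < b"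
    unfolding eventually_at_top_linorder by blast
  show ?thesis
  proof (rule that[of a "max 1 R0"])
    fix z :: complex assume z: "norm z \<ge> max 1 R0"
    define r where "r = norm z"
    have r: "r \<ge> 1" "r \<ge> R0" using z by (auto simp: r_def)
    have le: "norm (\<phi> z) \<le> max_modulus \<phi> r"
      using max_modulus_attained(2)[OF ent, of r z] by (simp add: r_def)
    have "ereal (ln (max_modulus \<phi> r) / r) < ereal a"
      using R0[OF r(2)] a(2) by order
    then have "ln (max_modulus \<phi> r) < a * r"
      using r(1) by (simp add: field_simps)
    then have "max_modulus \<phi> r \<le> exp (a * r)" if "max_modulus \<phi> r > 0"
      using that by (metis exp_le_cancel_iff exp_ln less_imp_le)
    then have "max_modulus \<phi> r \<le> exp (a * r)"
      by (cases "max_modulus \<phi> r > 0") (auto intro: order_trans[of _ 0])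
    then show "norm (\<phi> z) \<le> exp (a * norm z)" using le by (simp add: r_def)
  qed (use a in auto)
qed

text \<open>Cauchy's estimate on the circle of radius \<open>r = n + R\<close>: since
  \<open>n! \<le> n^n \<le> r^n\<close>, only \<open>exp (a * (n + R))\<close> is left, which is
  geometric in \<open>n\<close>.\<close>

lemma exponential_type_coeffs:
  assumes "exponential_type \<phi>"
  obtains C A where "exp_bounded C A (\<lambda>n. (deriv ^^ n) \<phi> 0 / fact n)"
proof -
  obtain a R where aR: "a > 0" "R > 0" and
    bd: "\<And>z. norm z \<ge> R \<Longrightarrow> norm (\<phi> z) \<le> exp (a * norm z)"
    using exponential_type_bound[OF assms] by blast
  have hol: "\<phi> holomorphic_on S" for S
    using assms holomorphic_on_subset unfolding exponential_type_def entire_def by blast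
  have "norm ((deriv ^^ n) \<phi> 0 / fact n) \<le> exp (a * R) * exp a ^ n / fact n" for n
  proof -
    define r where "r = real n + R"
    have r: "r > 0" "r \<ge> R" using aR by (auto simp: r_def)
    have "norm ((deriv ^^ n) \<phi> 0) \<le> fact n * exp (a * r) / r ^ n"
    proof (rule Cauchy_inequality)
      show "continuous_on (cball 0 r) \<phi>" using hol holomorphic_on_imp_continuous_on by blast
      show "norm (\<phi> x) \<le> exp (a * r)" if "norm (0 - x) = r" for x
        using bd[of x] that r by simp
    qed (use hol r in auto)
    also have "\<dots> \<le> r ^ n * exp (a * r) / r ^ n"
    proof -
      have "(fact n :: real) \<le> real (n ^ n)" by (rule fact_le_power)
      also have "\<dots> \<le> r ^ n" unfolding of_nat_power r_def using aR by (intro power_mono) auto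
      finally show ?thesis using r by (intro divide_right_mono mult_right_mono) auto
    qed
    also have "\<dots> = exp (a * R) * exp a ^ n"
      using r by (simp add: r_def exp_of_nat_mult[symmetric] exp_add[symmetric] algebra_simps)
    finally show ?thesis by (simp add: norm_divide divide_right_mono)
  qed
  then show ?thesis using that[of "exp (a * R)" "exp a"] unfolding exp_bounded_def by simp
qed

section \<open>Norm estimates for the operator and its iterates\<close>

lemma coeff_op_term_bound:
  assumes c: "exp_bounded C A c" and f: "f holomorphic_on UNIV"
    and M: "\<And>w. norm w \<le> r + 2 * A \<Longrightarrow> norm (f w) \<le> M" and z: "norm z \<le> r"
  shows "norm (c n * (deriv ^^ n) f z) \<le> C * M * (1 / 2) ^ n"
proof -
  have A: "A > 0" "C > 0" and cn: "norm (c n) \<le> C * A ^ n / fact n" using c by (auto simp: exp_bounded_def)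
  have hol: "f holomorphic_on S" for S using f holomorphic_on_subset by blast
  have M0: "M \<ge> 0" using M[of z] z A norm_ge_zero[of "f z"] by linarith
  \<comment> \<open>On a circle of radius \<open>2 * A\<close> the factorial from Cauchy's estimate
    cancels the one in the bound for \<open>c n\<close>, and the ratio of \<open>A\<close> to
    \<open>2 * A\<close> leaves \<open>(1/2)^n\<close>.\<close>
  have "norm ((deriv ^^ n) f z) \<le> fact n * M / (2 * A) ^ n"
  proof (rule Cauchy_inequality)
    show "continuous_on (cball z (2 * A)) f" using hol holomorphic_on_imp_continuous_on by blast
    show "norm (f x) \<le> M" if "norm (z - x) = 2 * A" for x
    proof (rule M)
      have "norm x \<le> norm z + norm (z - x)" by (metis norm_minus_commute norm_triangle_sub)
      then show "norm x \<le> r + 2 * A" using z that by linarith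
    qed
  qed (use hol A in auto)
  then have "norm (c n * (deriv ^^ n) f z) \<le> (C * A ^ n / fact n) * (fact n * M / (2 * A) ^ n)"
    unfolding norm_mult using cn A M0 by (intro mult_mono) auto
  also have "\<dots> = C * M * (1 / 2) ^ n" using A by (simp add: field_simps)
  finally show ?thesis .
qed

lemma entire_bounded_on_cball:
  assumes "f holomorphic_on UNIV"
  obtains M where "M > 0" "\<And>w::complex. norm w \<le> r \<Longrightarrow> norm (f w :: complex) \<le> M"
proof -
  have "compact (f ` cball 0 r)"
    using assms by (intro compact_continuous_image)
      (auto intro: holomorphic_on_imp_continuous_on holomorphic_on_subset)
  then obtain M where "M > 0" "\<forall>x\<in>f ` cball 0 r. norm x \<le> M"
    using compact_imp_bounded bounded_pos by blast
  then show ?thesis using that[of M] by auto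
qed

lemma coeff_op_summable:
  assumes "exp_bounded C A c" "f holomorphic_on UNIV"
  shows "summable (\<lambda>n. c n * (deriv ^^ n) f z)"
proof -
  obtain M where M: "\<And>w. norm w \<le> norm z + 2 * A \<Longrightarrow> norm (f w) \<le> M"
    using entire_bounded_on_cball[OF assms(2)] by metis
  show ?thesis
    by (rule summable_comparison_test'[OF _ coeff_op_term_bound[OF assms M order_refl]])
       (auto intro!: summable_mult)
qed

lemma coeff_op_norm_le:
  assumes "exp_bounded C A c" "f holomorphic_on UNIV"
    and "\<And>w. norm w \<le> r + 2 * A \<Longrightarrow> norm (f w) \<le> M" "norm z \<le> r"
  shows "norm (coeff_op c f z) \<le> 2 * C * M"
proof -
  have "norm (coeff_op c f z) \<le> (\<Sum>n. C * M * (1 / 2) ^ n)"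
    unfolding coeff_op_def by (rule norm_suminf_le[OF coeff_op_term_bound[OF assms]]) (auto intro!: summable_mult)
  also have "\<dots> = C * M * 2" by (subst suminf_mult) (auto simp: suminf_geometric)
  finally show ?thesis by simp
qed

lemma coeff_op_holomorphic:
  assumes "exp_bounded C A c" "f holomorphic_on UNIV"
  shows "coeff_op c f holomorphic_on UNIV"
proof -
  have "coeff_op c f holomorphic_on ball 0 r" if "r > 0" for r
  proof -
    obtain M where M: "\<And>w. norm w \<le> r + 2 * A \<Longrightarrow> norm (f w) \<le> M"
      using entire_bounded_on_cball[OF assms(2)] by metis
    have ulim: "uniform_limit (cball 0 r) (\<lambda>N z. \<Sum>n<N. c n * (deriv ^^ n) f z) (coeff_op c f) sequentially"
      unfolding coeff_op_def
      by (rule Weierstrass_m_test[where M = "\<lambda>n. C * M * (1 / 2) ^ n"])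
         (use coeff_op_term_bound[OF assms M] in \<open>auto intro!: summable_mult\<close>)
    have "(\<lambda>z. \<Sum>n<N. c n * (deriv ^^ n) f z) holomorphic_on UNIV" for N
      using assms(2) by (auto intro!: holomorphic_intros holomorphic_higher_deriv)
    then have hol: "(\<lambda>z. \<Sum>n<N. c n * (deriv ^^ n) f z) holomorphic_on S" for N S
      by (rule holomorphic_on_subset) simp
    show ?thesis
      by (rule holomorphic_uniform_limit[OF _ ulim]) (intro always_eventually allI conjI holomorphic_on_imp_continuous_on hol, simp)
  qed
  then have "coeff_op c f field_differentiable at z" for z
    using holomorphic_on_imp_differentiable_at[of "coeff_op c f" "ball 0 (norm z + 1)" z]
    by (auto simp: add_nonneg_pos)
  then show ?thesis by (simp add: holomorphic_on_def)
qed

lemma coeff_op_add: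
  assumes "exp_bounded C A c" "f holomorphic_on UNIV" "g holomorphic_on UNIV"
  shows "coeff_op c (\<lambda>z. f z + g z) = (\<lambda>z. coeff_op c f z + coeff_op c g z)"
proof
  fix z
  have "(deriv ^^ n) (\<lambda>z. f z + g z) z = (deriv ^^ n) f z + (deriv ^^ n) g z" for n
    by (rule higher_deriv_add[OF assms(2,3)]) auto
  then show "coeff_op c (\<lambda>z. f z + g z) z = coeff_op c f z + coeff_op c g z"
    unfolding coeff_op_def
    by (simp add: suminf_add[OF coeff_op_summable[OF assms(1,2)] coeff_op_summable[OF assms(1,3)]] ring_distribs)
qed

lemma coeff_op_cmult:
  assumes "exp_bounded C A c" "f holomorphic_on UNIV"
  shows "coeff_op c (\<lambda>z. k * f z) = (\<lambda>z. k * coeff_op c f z)"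
proof
  fix z
  have "(deriv ^^ n) (\<lambda>z. k * f z) z = k * (deriv ^^ n) f z" for n
    by (rule higher_deriv_cmult[OF assms(2)]) auto
  then show "coeff_op c (\<lambda>z. k * f z) z = k * coeff_op c f z"
    unfolding coeff_op_def
    using suminf_mult[OF coeff_op_summable[OF assms, of z], of k] by (simp add: mult_ac)
qed

lemma coeff_op_funpow_holomorphic:
  assumes "exp_bounded C A c" "f holomorphic_on UNIV"
  shows "(coeff_op c ^^ n) f holomorphic_on UNIV"
  by (induction n) (use assms coeff_op_holomorphic in auto)

lemma coeff_op_funpow_add:
  assumes "exp_bounded C A c" "f holomorphic_on UNIV" "g holomorphic_on UNIV"
  shows "(coeff_op c ^^ n) (\<lambda>z. f z + g z) = (\<lambda>z. (coeff_op c ^^ n) f z + (coeff_op c ^^ n) g z)"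
  by (induction n) (simp_all add: coeff_op_add[OF assms(1)] coeff_op_funpow_holomorphic[OF assms(1)] assms)

lemma coeff_op_funpow_norm_le:
  assumes c: "exp_bounded C A c" and f: "f holomorphic_on UNIV"
    and "\<And>w. norm w \<le> r + 2 * A * n \<Longrightarrow> norm (f w) \<le> M" "norm z \<le> r"
  shows "norm ((coeff_op c ^^ n) f z) \<le> (2 * C) ^ n * M"
  using assms(3-)
\<comment> \<open>The radius varies in the induction: bounding the last application on radius
  \<open>r\<close> requires the earlier iterate on radius \<open>r + 2 * A\<close>.\<close>
proof (induction n arbitrary: r z)
  case (Suc n)
  have "norm ((coeff_op c ^^ n) f w) \<le> (2 * C) ^ n * M" if "norm w \<le> r + 2 * A" for w
    by (rule Suc.IH[OF Suc.prems(1) that]) (simp add: algebra_simps)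
  then show ?case
    using coeff_op_norm_le[OF c coeff_op_funpow_holomorphic[OF c f], of r n _ z] Suc.prems(2)
    by (simp add: mult.assoc)
qed simp

section \<open>Commutation with multiplication by \<open>z\<close>\<close>

lemma exp_bounded_shift:
  assumes "exp_bounded C A c"
  shows "exp_bounded (C * A) A (\<lambda>n. of_nat (Suc n) * c (Suc n))"
proof -
  have "norm (of_nat (Suc n) * c (Suc n)) \<le> C * A * A ^ n / fact n" for n
  proof -
    have "norm (of_nat (Suc n) * c (Suc n)) \<le> real (Suc n) * (C * A ^ Suc n / fact (Suc n))"
      using assms unfolding exp_bounded_def norm_mult norm_of_nat by (intro mult_left_mono of_nat_0_le_iff) blast
    also have "\<dots> = C * A * A ^ n / fact n" by (simp add: field_simps del: of_nat_Suc)
    finally show ?thesis .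
  qed
  then show ?thesis using assms by (simp add: exp_bounded_def)
qed

lemma higher_deriv_times_id:
  assumes "f holomorphic_on UNIV"
  shows "(deriv ^^ Suc n) (\<lambda>z. z * f z) = (\<lambda>z. z * (deriv ^^ Suc n) f z + of_nat (Suc n) * (deriv ^^ n) f z)"
proof (induction n)
  have D: "((deriv ^^ n) f has_field_derivative (deriv ^^ Suc n) f z) (at z)" for n z
    using holomorphic_derivI[OF holomorphic_higher_deriv[OF assms open_UNIV], of z n] by simp
  {
    case 0
    show ?case
      by (rule ext, simp, rule DERIV_imp_deriv) (use D[of 0] in \<open>auto intro!: derivative_eq_intros\<close>)
  next
    case (Suc n)
    have "(deriv ^^ Suc (Suc n)) (\<lambda>z. z * f z) = deriv ((deriv ^^ Suc n) (\<lambda>z. z * f z))" by simp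
    also have "\<dots> = (\<lambda>z. z * (deriv ^^ Suc (Suc n)) f z + of_nat (Suc (Suc n)) * (deriv ^^ Suc n) f z)"
      unfolding Suc.IH
      by (rule ext, rule DERIV_imp_deriv, (rule derivative_eq_intros D refl)+) (simp add: algebra_simps)
    finally show ?case .
  }
qed

text \<open>The commutator of \<open>\<phi>(D)\<close> with multiplication by \<open>z\<close> is
  \<open>\<phi>'(D)\<close>: the shifted coefficients are the Taylor coefficients of the derived
  symbol. This is what allows induction on the degree of a polynomial factor.\<close>

lemma coeff_op_times_id:
  assumes c: "exp_bounded C A c" and f: "f holomorphic_on UNIV"
  shows "coeff_op c (\<lambda>z. z * f z) =
    (\<lambda>z. z * coeff_op c f z + coeff_op (\<lambda>n. of_nat (Suc n) * c (Suc n)) f z)"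
proof
  fix z
  let ?t = "\<lambda>n. c n * (deriv ^^ n) f z"
  let ?g = "\<lambda>z. z * f z"
  let ?s = "\<lambda>n. of_nat (Suc n) * c (Suc n) * (deriv ^^ n) f z"
  have S: "summable ?t" by (rule coeff_op_summable[OF c f])
  have S': "summable ?s" by (rule coeff_op_summable[OF exp_bounded_shift[OF c] f])
  have S1: "summable (\<lambda>n. ?t (Suc n))" by (rule summable_Suc_iff[THEN iffD2, OF S])
  have "coeff_op c ?g z = c 0 * ?g z + (\<Sum>n. c (Suc n) * (deriv ^^ Suc n) ?g z)"
    unfolding coeff_op_def using suminf_split_head[OF coeff_op_summable[OF c, of ?g z]] f
    by (simp add: holomorphic_intros del: funpow.simps(2))
  also have "(\<lambda>n. c (Suc n) * (deriv ^^ Suc n) ?g z) = (\<lambda>n. z * ?t (Suc n) + ?s n)"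
    unfolding higher_deriv_times_id[OF f] by (simp add: algebra_simps)
  also have "suminf \<dots> = z * (suminf ?t - ?t 0) + suminf ?s"
    unfolding suminf_split_head[OF S, symmetric] suminf_mult[OF S1, symmetric]
    by (rule suminf_add[OF summable_mult[OF S1] S', symmetric])
  finally show "coeff_op c ?g z = z * coeff_op c f z + coeff_op (\<lambda>n. of_nat (Suc n) * c (Suc n)) f z"
    by (simp add: coeff_op_def algebra_simps)
qed

section \<open>Exponentials as eigenvectors and values of the symbol\<close>

lemma higher_deriv_exp_fun: "(deriv ^^ n) (exp_fun \<alpha>) = (\<lambda>z. \<alpha> ^ n * exp_fun \<alpha> z)"
proof (induction n)
  case (Suc n)
  have "(exp_fun \<alpha> has_field_derivative \<alpha> * exp_fun \<alpha> z) (at z)" for z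
    unfolding exp_fun_def by (auto intro!: derivative_eq_intros)
  then have "deriv (\<lambda>z. \<alpha> ^ n * exp_fun \<alpha> z) = (\<lambda>z. \<alpha> ^ n * (\<alpha> * exp_fun \<alpha> z))"
    by (intro ext DERIV_imp_deriv DERIV_cmult)
  then show ?case by (simp add: Suc mult_ac)
qed simp

lemma exp_fun_holomorphic [holomorphic_intros]: "exp_fun \<alpha> holomorphic_on S"
  unfolding exp_fun_def by (intro holomorphic_intros)

lemma coeff_op_exp_fun:
  assumes c: "exp_bounded C A c"
  shows "coeff_op c (exp_fun \<alpha>) = (\<lambda>z. (\<Sum>n. c n * \<alpha> ^ n) * exp_fun \<alpha> z)"
proof
  fix z
  have nz: "exp_fun \<alpha> z \<noteq> 0" by (simp add: exp_fun_def)
  \<comment> \<open>Dividing by the nonvanishing exponential turns convergence of the operator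
    series into convergence of the symbol's power series at \<open>\<alpha>\<close>.\<close>
  have "summable (\<lambda>n. exp_fun \<alpha> z * (c n * \<alpha> ^ n))"
    using coeff_op_summable[OF c exp_fun_holomorphic[of \<alpha>], of z] by (simp add: higher_deriv_exp_fun mult_ac)
  then have "summable (\<lambda>n. c n * \<alpha> ^ n)" using nz by (simp add: summable_cmult_iff)
  from suminf_mult2[OF this, of "exp_fun \<alpha> z"]
  show "coeff_op c (exp_fun \<alpha>) z = (\<Sum>n. c n * \<alpha> ^ n) * exp_fun \<alpha> z"
    by (simp add: coeff_op_def higher_deriv_exp_fun mult_ac)
qed

lemma diff_op_symbol_values:
  assumes "\<phi> holomorphic_on UNIV"
  shows "(\<Sum>n. (deriv ^^ n) \<phi> 0 / fact n * \<alpha> ^ n) = \<phi> \<alpha>"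
    and "(\<Sum>n. of_nat (Suc n) * ((deriv ^^ Suc n) \<phi> 0 / fact (Suc n)) * \<alpha> ^ n) = deriv \<phi> \<alpha>"
proof -
  have taylor: "(\<Sum>n. (deriv ^^ n) f 0 / fact n * \<alpha> ^ n) = f \<alpha>" if "f holomorphic_on UNIV" for f
    using holomorphic_power_series[of f 0 "norm \<alpha> + 1" \<alpha>] that
    by (auto simp: sums_iff add_nonneg_pos intro: holomorphic_on_subset)
  show "(\<Sum>n. (deriv ^^ n) \<phi> 0 / fact n * \<alpha> ^ n) = \<phi> \<alpha>" using taylor[OF assms] .
  have "of_nat (Suc n) * ((deriv ^^ Suc n) \<phi> 0 / fact (Suc n)) = (deriv ^^ n) (deriv \<phi>) 0 / fact n" for n
    by (simp add: funpow_swap1 field_simps del: of_nat_Suc)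
  then show "(\<Sum>n. of_nat (Suc n) * ((deriv ^^ Suc n) \<phi> 0 / fact (Suc n)) * \<alpha> ^ n) = deriv \<phi> \<alpha>"
    using taylor[OF holomorphic_deriv[OF assms]] by simp
qed

section \<open>Polynomials times an exponential\<close>

definition weighted_poly :: "complex \<Rightarrow> complex poly \<Rightarrow> complex \<Rightarrow> complex" where
  "weighted_poly \<alpha> P = (\<lambda>z. poly P z * exp_fun \<alpha> z)"

lemma weighted_poly_holomorphic [holomorphic_intros]: "weighted_poly \<alpha> P holomorphic_on S"
  unfolding weighted_poly_def by (intro holomorphic_intros)

lemma weighted_poly_simps:
  "weighted_poly \<alpha> 0 z = 0"
  "weighted_poly \<alpha> (P + Q) z = weighted_poly \<alpha> P z + weighted_poly \<alpha> Q z"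
  "weighted_poly \<alpha> (P - Q) z = weighted_poly \<alpha> P z - weighted_poly \<alpha> Q z"
  "weighted_poly \<alpha> (smult k P) z = k * weighted_poly \<alpha> P z"
  "weighted_poly \<alpha> (sum G I) z = (\<Sum>i\<in>I. weighted_poly \<alpha> (G i) z)"
  by (simp_all add: weighted_poly_def algebra_simps poly_sum sum_distrib_left sum_distrib_right)

lemma coeff_op_weighted_poly_add:
  assumes "exp_bounded C A c"
  shows "coeff_op c (weighted_poly \<alpha> (P + Q)) z =
    coeff_op c (weighted_poly \<alpha> P) z + coeff_op c (weighted_poly \<alpha> Q) z"
proof -
  have "weighted_poly \<alpha> (P + Q) = (\<lambda>z. weighted_poly \<alpha> P z + weighted_poly \<alpha> Q z)"
    by (rule ext) (rule weighted_poly_simps)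
  then show ?thesis using coeff_op_add[OF assms] by (simp add: weighted_poly_holomorphic)
qed

lemma coeff_op_weighted_poly_smult:
  assumes "exp_bounded C A c"
  shows "coeff_op c (weighted_poly \<alpha> (smult k P)) z = k * coeff_op c (weighted_poly \<alpha> P) z"
proof -
  have "weighted_poly \<alpha> (smult k P) = (\<lambda>z. k * weighted_poly \<alpha> P z)"
    by (rule ext) (rule weighted_poly_simps)
  then show ?thesis using coeff_op_cmult[OF assms] by (simp add: weighted_poly_holomorphic)
qed

lemma coeff_op_weighted_poly_0:
  assumes "exp_bounded C A c"
  shows "coeff_op c (weighted_poly \<alpha> 0) z = 0"
  using coeff_op_weighted_poly_smult[OF assms, of \<alpha> 0 0 z] by simp

lemma coeff_op_weighted_poly_sum:
  assumes "exp_bounded C A c" "finite I"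
  shows "coeff_op c (weighted_poly \<alpha> (\<Sum>i\<in>I. smult (a i) (G i))) z =
    (\<Sum>i\<in>I. a i * coeff_op c (weighted_poly \<alpha> (G i)) z)"
  using assms(2)
  by (induction I) (simp_all add: coeff_op_weighted_poly_0[OF assms(1)]
      coeff_op_weighted_poly_add[OF assms(1)] coeff_op_weighted_poly_smult[OF assms(1)])

text \<open>With \<open>\<kappa>\<close> and \<open>\<mu>\<close> the values at
  \<open>\<alpha>\<close> of the symbol and of its derivative, \<open>z^j\<close> is sent to
  \<open>\<kappa> z^j + j \<mu> z^(j-1) + ...\<close>. The commutator formula raises
  \<open>j\<close> by one, and the leading term \<open>\<mu>\<close> contributed by the derived
  symbol turns \<open>j \<mu>\<close> into \<open>(j + 1) \<mu>\<close>. The sequence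
  \<open>c\<close> must vary in the induction so that the derived symbol is covered too.\<close>

lemma coeff_op_weighted_monom:
  assumes "exp_bounded C A c"
  shows "\<exists>R. coeff_op c (weighted_poly \<alpha> (monom 1 j)) = weighted_poly \<alpha> R \<and> degree R \<le> j \<and>
    coeff R j = (\<Sum>n. c n * \<alpha> ^ n) \<and>
    (j > 0 \<longrightarrow> coeff R (j - 1) = of_nat j * (\<Sum>n. of_nat (Suc n) * c (Suc n) * \<alpha> ^ n))"
  using assms
proof (induction j arbitrary: C c)
  case 0
  have "weighted_poly \<alpha> (monom 1 0) = exp_fun \<alpha>" by (auto simp: weighted_poly_def)
  then have "coeff_op c (weighted_poly \<alpha> (monom 1 0)) = weighted_poly \<alpha> [:\<Sum>n. c n * \<alpha> ^ n:]"
    by (simp only: coeff_op_exp_fun[OF 0]) (simp add: weighted_poly_def)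
  then show ?case by (intro exI[of _ "[:\<Sum>n. c n * \<alpha> ^ n:]"]) simp
next
  case (Suc j)
  define c' where "c' = (\<lambda>n. of_nat (Suc n) * c (Suc n))"
  have c': "exp_bounded (C * A) A c'" unfolding c'_def by (rule exp_bounded_shift[OF Suc.prems])
  obtain R where R: "coeff_op c (weighted_poly \<alpha> (monom 1 j)) = weighted_poly \<alpha> R" "degree R \<le> j"
    "coeff R j = (\<Sum>n. c n * \<alpha> ^ n)" "j > 0 \<Longrightarrow> coeff R (j - 1) = of_nat j * (\<Sum>n. c' n * \<alpha> ^ n)"
    using Suc.IH[OF Suc.prems] unfolding c'_def by blast
  obtain S where S: "coeff_op c' (weighted_poly \<alpha> (monom 1 j)) = weighted_poly \<alpha> S" "degree S \<le> j"
    "coeff S j = (\<Sum>n. c' n * \<alpha> ^ n)"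
    using Suc.IH[OF c'] by blast
  have "weighted_poly \<alpha> (monom 1 (Suc j)) = (\<lambda>z. z * weighted_poly \<alpha> (monom 1 j) z)"
    by (auto simp: weighted_poly_def poly_monom)
  then have "coeff_op c (weighted_poly \<alpha> (monom 1 (Suc j))) = weighted_poly \<alpha> (pCons 0 R + S)"
    using coeff_op_times_id[OF Suc.prems weighted_poly_holomorphic] R(1) S(1)
    by (auto simp: weighted_poly_def c'_def algebra_simps)
  moreover have "degree (pCons 0 R + S) \<le> Suc j"
    using R(2) S(2) degree_pCons_le[of 0 R] by (intro degree_add_le) linarith+
  moreover have "coeff (pCons 0 R + S) (Suc j) = (\<Sum>n. c n * \<alpha> ^ n)"
    using R(3) S(2) by (simp add: coeff_eq_0)
  moreover have "coeff (pCons 0 R + S) j = of_nat (Suc j) * (\<Sum>n. c' n * \<alpha> ^ n)"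
    using R(4) S(3) by (cases j) (auto simp: algebra_simps)
  ultimately show ?case unfolding c'_def by (metis diff_Suc_1)
qed

text \<open>On polynomials times the exponential, the operator minus \<open>\<kappa>\<close> lowers
  the degree by one and multiplies the leading coefficient by \<open>n * \<mu>\<close>, so it can be
  inverted from the top coefficient downwards. The top coefficient of \<open>P\<close> is recorded
  because it later fixes the exact degree. Vanishing of coefficients, rather than a degree bound,
  lets \<open>n = 0\<close> mean \<open>Q = 0\<close>.\<close>

lemma coeff_op_solve:
  assumes c: "exp_bounded C A c"
    and \<kappa>: "\<kappa> = (\<Sum>n. c n * \<alpha> ^ n)"
    and \<mu>: "\<mu> = (\<Sum>n. of_nat (Suc n) * c (Suc n) * \<alpha> ^ n)" "\<mu> \<noteq> 0"
  shows "(\<And>i. i \<ge> n \<Longrightarrow> coeff Q i = 0) \<Longrightarrow>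
    \<exists>P. degree P \<le> n \<and> (n > 0 \<longrightarrow> coeff P n = coeff Q (n - 1) / (of_nat n * \<mu>)) \<and>
      coeff_op c (weighted_poly \<alpha> P) = weighted_poly \<alpha> (smult \<kappa> P + Q)"
proof (induction n arbitrary: Q)
  case 0
  then have "Q = 0" by (simp add: poly_eq_iff)
  have "coeff_op c (weighted_poly \<alpha> 0) = weighted_poly \<alpha> (smult \<kappa> 0 + 0)"
    by (rule ext, subst coeff_op_weighted_poly_0[OF c], simp add: weighted_poly_def)
  then show ?case using \<open>Q = 0\<close> by (intro exI[of _ 0]) simp
next
  case (Suc n)
  obtain R where R: "coeff_op c (weighted_poly \<alpha> (monom 1 (Suc n))) = weighted_poly \<alpha> R"
    "degree R \<le> Suc n" "coeff R (Suc n) = \<kappa>" "coeff R n = of_nat (Suc n) * \<mu>"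
    using coeff_op_weighted_monom[OF c, of \<alpha> "Suc n"] unfolding \<kappa>[symmetric] \<mu>(1)[symmetric] by auto
  \<comment> \<open>This \<open>k\<close> cancels the coefficient of \<open>Q\<close> at
    \<open>n\<close>; subtracting \<open>monom \<kappa> (Suc n)\<close> removes the eigenvalue part,
    so \<open>Q'\<close> has no terms from degree \<open>n\<close> on.\<close>
  define k where "k = coeff Q n / (of_nat (Suc n) * \<mu>)"
  define Q' where "Q' = Q - smult k (R - monom \<kappa> (Suc n))"
  have "coeff Q' i = 0" if "i \<ge> n" for i
  proof -
    have "i = n \<or> i = Suc n \<or> i > Suc n" using that by arith
    then consider "i = n" | "i = Suc n" | "i > Suc n" by blast
    then show ?thesis
    proof cases
      case 1
      then show ?thesis using R(4) \<mu>(2) by (simp add: Q'_def k_def coeff_monom del: of_nat_Suc)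
    qed (use R(2,3) Suc.prems in \<open>auto simp: Q'_def coeff_monom coeff_eq_0\<close>)
  qed
  then obtain P where P: "degree P \<le> n"
    "coeff_op c (weighted_poly \<alpha> P) = weighted_poly \<alpha> (smult \<kappa> P + Q')"
    using Suc.IH[of Q'] by blast
  define P' where "P' = smult k (monom 1 (Suc n)) + P"
  have "degree P' \<le> Suc n"
    unfolding P'_def using P(1) degree_monom_le[of "1::complex" "Suc n"] degree_smult_le[of k "monom 1 (Suc n)"]
    by (intro degree_add_le) linarith+
  moreover have "coeff P' (Suc n) = k"
    using P(1) by (simp add: P'_def coeff_eq_0)
  moreover have "coeff_op c (weighted_poly \<alpha> P') = weighted_poly \<alpha> (smult \<kappa> P' + Q)"
  proof
    fix z
    have "weighted_poly \<alpha> (monom \<kappa> (Suc n)) z = \<kappa> * weighted_poly \<alpha> (monom 1 (Suc n)) z"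
      by (simp add: weighted_poly_def poly_monom)
    then show "coeff_op c (weighted_poly \<alpha> P') z = weighted_poly \<alpha> (smult \<kappa> P' + Q) z"
      unfolding P'_def Q'_def coeff_op_weighted_poly_add[OF c] coeff_op_weighted_poly_smult[OF c] R(1) P(2)
      by (simp add: weighted_poly_simps algebra_simps del: smult_monom)
  qed
  ultimately show ?case unfolding k_def by (intro exI[of _ P']) simp
qed

text \<open>Start from the constant 1 and repeatedly solve for \<open>b (Suc j)\<close> with
  right-hand side \<open>\<kappa>\<close> times \<open>b j\<close>. As \<open>\<kappa>\<close> and
  \<open>\<mu>\<close> are nonzero, the new leading coefficient is nonzero, so the degree rises by
  exactly one.\<close>

lemma triangular_basis_exists:
  assumes c: "exp_bounded C A c"
    and \<kappa>: "\<kappa> = (\<Sum>n. c n * \<alpha> ^ n)" "\<kappa> \<noteq> 0"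
    and \<mu>: "\<mu> = (\<Sum>n. of_nat (Suc n) * c (Suc n) * \<alpha> ^ n)" "\<mu> \<noteq> 0"
  obtains b where "\<And>j. degree (b j) = j" "\<And>j. b j \<noteq> 0"
    "coeff_op c (weighted_poly \<alpha> (b 0)) = weighted_poly \<alpha> (smult \<kappa> (b 0))"
    "\<And>j. coeff_op c (weighted_poly \<alpha> (b (Suc j))) = weighted_poly \<alpha> (smult \<kappa> (b (Suc j) + b j))"
proof -
  note solve = coeff_op_solve[OF c \<kappa>(1) \<mu>]
  let ?P = "\<lambda>n x. degree x = n \<and> x \<noteq> 0 \<and> (n = 0 \<longrightarrow> coeff_op c (weighted_poly \<alpha> x) = weighted_poly \<alpha> (smult \<kappa> x))"
  let ?Q = "\<lambda>n x y. coeff_op c (weighted_poly \<alpha> y) = weighted_poly \<alpha> (smult \<kappa> (y + x))"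
  have "\<exists>b. \<forall>n. ?P n (b n) \<and> ?Q n (b n) (b (Suc n))"
  proof (rule dependent_nat_choice)
    have "weighted_poly \<alpha> 1 = exp_fun \<alpha>" by (auto simp: weighted_poly_def)
    then have "coeff_op c (weighted_poly \<alpha> 1) = weighted_poly \<alpha> (smult \<kappa> 1)"
      using coeff_op_exp_fun[OF c, of \<alpha>] \<kappa>(1) by (auto simp: weighted_poly_def)
    then show "\<exists>x. ?P 0 x" by (intro exI[of _ 1]) simp
  next
    fix x n assume x: "?P n x"
    have "coeff (smult \<kappa> x) i = 0" if "i \<ge> Suc n" for i using x that by (simp add: coeff_eq_0)
    then obtain y where y: "degree y \<le> Suc n" "coeff y (Suc n) = coeff (smult \<kappa> x) n / (of_nat (Suc n) * \<mu>)"
      "coeff_op c (weighted_poly \<alpha> y) = weighted_poly \<alpha> (smult \<kappa> y + smult \<kappa> x)"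
      using solve[of "Suc n" "smult \<kappa> x"] by auto
    have "coeff x n \<noteq> 0" using x leading_coeff_0_iff by blast
    then have "coeff y (Suc n) \<noteq> 0" using y(2) \<kappa>(2) \<mu>(2) by (simp del: of_nat_Suc)
    then have "degree y = Suc n" "y \<noteq> 0" using y(1) le_degree[of y "Suc n"] by auto
    then show "\<exists>y. ?P (Suc n) y \<and> ?Q n x y" using y(3) by (intro exI[of _ y]) (simp add: smult_add_right)
  qed
  then show ?thesis using that by blast
qed

lemma graded_basis_spans:
  fixes b :: "nat \<Rightarrow> 'a :: field poly"
  assumes "\<And>j. degree (b j) = j" "\<And>j. b j \<noteq> 0"
  shows "(\<And>i. i \<ge> n \<Longrightarrow> coeff P i = 0) \<Longrightarrow> \<exists>a. P = (\<Sum>j<n. smult (a j) (b j))"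
proof (induction n arbitrary: P)
  case 0
  then show ?case by (simp add: poly_eq_iff)
next
  case (Suc n)
  define k where "k = coeff P n / coeff (b n) n"
  have bn: "coeff (b n) n \<noteq> 0" using assms leading_coeff_0_iff by metis
  have "coeff (P - smult k (b n)) i = 0" if "i \<ge> n" for i
    using bn that Suc.prems[of i] assms(1)[of n] by (cases "i = n") (auto simp: k_def coeff_eq_0)
  then obtain a where a: "P - smult k (b n) = (\<Sum>j<n. smult (a j) (b j))" using Suc.IH by blast
  then have "P = (\<Sum>j<Suc n. smult ((a(n := k)) j) (b j))"
    by (simp add: algebra_simps)
  then show ?case by blast
qed

section \<open>Finite differences\<close>

definition fdiff :: "(complex \<Rightarrow> complex) \<Rightarrow> complex \<Rightarrow> complex" where
  "fdiff g = (\<lambda>x. g (x + 1) - g x)"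

lemma fdiff_funpow_add: "(fdiff ^^ k) (\<lambda>x. f x + g x) = (\<lambda>x. (fdiff ^^ k) f x + (fdiff ^^ k) g x)"
  by (induction k) (auto simp: fdiff_def)

lemma fdiff_funpow_diff: "(fdiff ^^ k) (\<lambda>x. f x - g x) = (\<lambda>x. (fdiff ^^ k) f x - (fdiff ^^ k) g x)"
  by (induction k) (auto simp: fdiff_def)

lemma fdiff_funpow_cmult: "(fdiff ^^ k) (\<lambda>x. a * g x) = (\<lambda>x. a * (fdiff ^^ k) g x)"
  by (induction k) (auto simp: fdiff_def algebra_simps)

lemma fdiff_funpow_zero: "(fdiff ^^ k) (\<lambda>x. 0) = (\<lambda>x. 0)"
  using fdiff_funpow_cmult[of k 0] by simp

lemma fdiff_funpow_sum: "(fdiff ^^ k) (\<lambda>x. \<Sum>i\<in>I. g i x) = (\<lambda>x. \<Sum>i\<in>I. (fdiff ^^ k) (g i) x)"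
  by (induction I rule: infinite_finite_induct) (simp_all add: fdiff_funpow_zero fdiff_funpow_add)

lemma fdiff_funpow_shift: "(fdiff ^^ k) (\<lambda>x. g (x + a)) = (\<lambda>x. (fdiff ^^ k) g (x + a))"
  by (induction k) (auto simp: fdiff_def algebra_simps)

text \<open>Pascal's rule: under differences the binomial polynomials behave as the normalised
  monomials \<open>x^j / j!\<close> do under differentiation.\<close>

lemma fdiff_funpow_gbinomial:
  "(fdiff ^^ k) (\<lambda>x. x gchoose j) = (\<lambda>x. if k \<le> j then x gchoose (j - k) else 0)"
proof (induction k)
  case (Suc k)
  show ?case
  proof (cases "k < j")
    case True
    then have "j - k = Suc (j - Suc k)" by simp
    then show ?thesis using True Suc by (auto simp: fdiff_def gbinomial_Suc_Suc)
  qed (use Suc in \<open>auto simp: fdiff_def\<close>)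
qed simp

text \<open>An iterated difference is a finite combination of values. This converts pointwise limits
  into limits of Newton coefficients.\<close>

lemma fdiff_funpow_tendsto_0:
  assumes "\<And>x. ((\<lambda>n. g n x) \<longlongrightarrow> 0) F"
  shows "((\<lambda>n. (fdiff ^^ k) (g n) x) \<longlongrightarrow> 0) F"
proof (induction k arbitrary: x)
  case (Suc k)
  show ?case using tendsto_diff[OF Suc[of "x + 1"] Suc[of x]] by (simp add: fdiff_def)
qed (use assms in simp)

text \<open>For polynomial functions this says that the degree is less than \<open>k\<close>.\<close>

definition fdeg_less :: "nat \<Rightarrow> (complex \<Rightarrow> complex) \<Rightarrow> bool" where
  "fdeg_less k g \<longleftrightarrow> (fdiff ^^ k) g = (\<lambda>x. 0)"

lemma fdeg_less_mono:
  assumes "fdeg_less k g" "k \<le> l"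
  shows "fdeg_less l g"
proof -
  have "fdiff ^^ l = (fdiff ^^ (l - k)) \<circ> (fdiff ^^ k)"
    using assms(2) by (simp flip: funpow_add)
  then show ?thesis using assms(1) by (simp add: fdeg_less_def fdiff_funpow_zero)
qed

lemma fdeg_less_Suc: "fdeg_less (Suc k) g \<longleftrightarrow> fdeg_less k (fdiff g)"
  by (simp add: fdeg_less_def funpow_swap1)

lemma fdeg_less_add: "fdeg_less k f \<Longrightarrow> fdeg_less k g \<Longrightarrow> fdeg_less k (\<lambda>x. f x + g x)"
  and fdeg_less_diff: "fdeg_less k f \<Longrightarrow> fdeg_less k g \<Longrightarrow> fdeg_less k (\<lambda>x. f x - g x)"
  and fdeg_less_cmult: "fdeg_less k f \<Longrightarrow> fdeg_less k (\<lambda>x. a * f x)"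
  and fdeg_less_shift: "fdeg_less k f \<Longrightarrow> fdeg_less k (\<lambda>x. f (x + a))"
  by (simp_all add: fdeg_less_def fdiff_funpow_add fdiff_funpow_diff fdiff_funpow_cmult fdiff_funpow_shift)

lemma fdeg_less_const: "fdeg_less (Suc k) (\<lambda>x. a)"
  by (rule fdeg_less_mono[of 1]) (auto simp: fdeg_less_def fdiff_def)

lemma fdeg_less_linear: "fdeg_less 2 (\<lambda>x. x / a)"
  by (auto simp: fdeg_less_def fdiff_def eval_nat_numeral diff_divide_distrib[symmetric])

text \<open>Induction through the product rule for differences, in which one factor is shifted by 1.
  If \<open>k\<close> or \<open>l\<close> is 0, one factor is the zero function, so the truncated
  subtraction does no harm.\<close>

lemma fdeg_less_mult_aux:
  "fdeg_less k f \<Longrightarrow> fdeg_less l g \<Longrightarrow> fdeg_less (k + l - 1) (\<lambda>x. f x * g x)"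
proof (induction "k + l" arbitrary: k l f g rule: less_induct)
  case less
  show ?case
  proof (cases "k = 0 \<or> l = 0")
    case True
    then show ?thesis using less.prems by (auto simp: fdeg_less_def fdiff_funpow_zero)
  next
    case False
    then obtain k' l' where kl: "k = Suc k'" "l = Suc l'" by (auto simp: gr0_conv_Suc)
    have eq: "fdiff (\<lambda>x. f x * g x) = (\<lambda>x. fdiff f x * g (x + 1) + f x * fdiff g x)"
      by (auto simp: fdiff_def algebra_simps)
    have "fdeg_less (k' + l - 1) (\<lambda>x. fdiff f x * g (x + 1))"
      using less.prems kl by (intro less.hyps fdeg_less_shift) (auto simp: fdeg_less_Suc)
    moreover have "fdeg_less (k + l' - 1) (\<lambda>x. f x * fdiff g x)"
      using less.prems kl by (intro less.hyps) (auto simp: fdeg_less_Suc)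
    ultimately show ?thesis using kl fdeg_less_add by (simp add: fdeg_less_Suc eq)
  qed
qed

lemma fdeg_less_mult:
  "fdeg_less (Suc k) f \<Longrightarrow> fdeg_less (Suc l) g \<Longrightarrow> fdeg_less (Suc (k + l)) (\<lambda>x. f x * g x)"
  using fdeg_less_mult_aux[of "Suc k" f "Suc l" g] by simp

lemma fdeg_less_power: "fdeg_less (Suc k) f \<Longrightarrow> fdeg_less (Suc (m * k)) (\<lambda>x. f x ^ m)"
proof (induction m)
  case (Suc m)
  then show ?case using fdeg_less_mult[of k f "m * k" "\<lambda>x. f x ^ m"] by simp
qed (use fdeg_less_const in simp)

section \<open>Newton series and the conjugacy with translation\<close>

definition newton_sum :: "(nat \<Rightarrow> complex) \<Rightarrow> nat \<Rightarrow> complex \<Rightarrow> complex" where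
  "newton_sum u d x = (\<Sum>j\<le>d. u j * (x gchoose j))"

lemma fdiff_funpow_newton_sum:
  "(fdiff ^^ k) (newton_sum u d) = (\<lambda>x. \<Sum>j\<le>d. u j * (if k \<le> j then x gchoose (j - k) else 0))"
  unfolding newton_sum_def fdiff_funpow_sum fdiff_funpow_cmult fdiff_funpow_gbinomial ..

text \<open>At 0 only the term with \<open>j = k\<close> survives, so the differences at 0 recover
  the Newton coefficients.\<close>

lemma fdiff_newton_sum_at_0: "(fdiff ^^ k) (newton_sum u d) 0 = (if k \<le> d then u k else 0)"
proof -
  have "(fdiff ^^ k) (newton_sum u d) 0 = (\<Sum>j\<le>d. if j = k then u j else 0)"
    unfolding fdiff_funpow_newton_sum by (intro sum.cong) (auto simp: gbinomial_0_left)
  then show ?thesis by simp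
qed

lemma fdeg_less_newton_sum: "fdeg_less (Suc d) (newton_sum u d)"
  unfolding fdeg_less_def fdiff_funpow_newton_sum by (auto intro!: ext sum.neutral)

text \<open>Each further factor \<open>(x - j) / (j + 1)\<close> has modulus at most
  \<open>1 + |x|\<close>.\<close>

lemma norm_gbinomial_le: "norm ((x::complex) gchoose j) \<le> (1 + norm x) ^ j"
proof (induction j)
  case (Suc j)
  have "x gchoose Suc j = (x gchoose j) * ((x - of_nat j) / of_nat (Suc j))"
    by (simp add: gbinomial_prod_rev field_simps)
  moreover have "norm ((x - of_nat j) / of_nat (Suc j)) \<le> 1 + norm x"
  proof -
    have "norm (x - of_nat j) \<le> norm x + real j"
      using norm_triangle_ineq4[of x "of_nat j"] by simp
    also have "\<dots> \<le> (1 + norm x) * real (Suc j)" by (simp add: algebra_simps)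
    finally show ?thesis by (simp add: norm_divide divide_le_eq del: of_nat_Suc)
  qed
  ultimately show ?case
    using mult_mono[OF Suc, of "norm ((x - of_nat j) / of_nat (Suc j))" "1 + norm x"]
    by (simp only: norm_mult power_Suc2) simp
qed simp

lemma norm_newton_sum_le:
  "norm (newton_sum u d x) \<le> (\<Sum>j\<le>d. norm (u j)) * (1 + norm x) ^ d"
proof -
  have "norm (newton_sum u d x) \<le> (\<Sum>j\<le>d. norm (u j) * (1 + norm x) ^ d)"
    unfolding newton_sum_def
  proof (rule sum_norm_le)
    fix j assume j: "j \<in> {..d}"
    have "norm (x gchoose j) \<le> (1 + norm x) ^ d"
      using norm_gbinomial_le[of x j] power_increasing[of j d "1 + norm x"] j by auto
    then show "norm (u j * (x gchoose j)) \<le> norm (u j) * (1 + norm x) ^ d"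
      by (simp add: norm_mult mult_left_mono)
  qed
  then show ?thesis by (simp add: sum_distrib_right)
qed

lemma smult_sum_right: "smult a (sum f I) = (\<Sum>i\<in>I. smult a (f i))"
  by (induction I rule: infinite_finite_induct) (simp_all add: smult_add_right)

text \<open>By Newton's interpolation formula this is the linear map sending \<open>x gchoose j\<close> to \<open>b j\<close>,
  on polynomial functions of degree at most \<open>N\<close>.\<close>

definition newton_poly :: "(nat \<Rightarrow> complex poly) \<Rightarrow> nat \<Rightarrow> (complex \<Rightarrow> complex) \<Rightarrow> complex poly" where
  "newton_poly b N g = (\<Sum>j\<le>N. smult ((fdiff ^^ j) g 0) (b j))"

lemma newton_poly_add: "newton_poly b N (\<lambda>x. f x + g x) = newton_poly b N f + newton_poly b N g"
  by (simp add: newton_poly_def fdiff_funpow_add smult_add_left sum.distrib)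

lemma newton_poly_cmult: "newton_poly b N (\<lambda>x. a * g x) = smult a (newton_poly b N g)"
  by (simp add: newton_poly_def fdiff_funpow_cmult smult_sum_right)

lemma newton_poly_newton_sum:
  assumes "d \<le> N"
  shows "newton_poly b N (newton_sum u d) = (\<Sum>j\<le>d. smult (u j) (b j))"
proof -
  have "newton_poly b N (newton_sum u d) = (\<Sum>j\<le>N. if j \<le> d then smult (u j) (b j) else 0)"
    unfolding newton_poly_def fdiff_newton_sum_at_0 by (intro sum.cong) auto
  also have "\<dots> = (\<Sum>j\<in>{..N} \<inter> {j. j \<le> d}. smult (u j) (b j))"
    by (simp add: sum.inter_restrict)
  also have "{..N} \<inter> {j. j \<le> d} = {..d}" using assms by auto
  finally show ?thesis .
qed

text \<open>Summation by parts. The boundary term is kept so that the induction closes; in the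
  application it vanishes because \<open>a (Suc N) = 0\<close>.\<close>

lemma sum_times_binomial_recurrence:
  fixes a t w :: "nat \<Rightarrow> 'a :: comm_ring_1"
  assumes "t 0 = k * w 0" "\<And>j. t (Suc j) = k * (w (Suc j) + w j)"
  shows "(\<Sum>j\<le>N. a j * t j) + k * a (Suc N) * w N = k * (\<Sum>j\<le>N. (a j + a (Suc j)) * w j)"
  by (induction N) (simp_all add: assms algebra_simps)

text \<open>Translating \<open>g\<close> by 1 changes its difference \<open>a j\<close> at 0 into
  \<open>a j + a (Suc j)\<close>. Moving the recurrence of \<open>b\<close> onto the coefficients by
  summation by parts produces the same sums, times \<open>\<kappa>\<close>.\<close>

lemma coeff_op_newton_poly:
  assumes c: "exp_bounded C A c"
    and b: "coeff_op c (weighted_poly \<alpha> (b 0)) = weighted_poly \<alpha> (smult \<kappa> (b 0))"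
      "\<And>j. coeff_op c (weighted_poly \<alpha> (b (Suc j))) = weighted_poly \<alpha> (smult \<kappa> (b (Suc j) + b j))"
    and g: "fdeg_less (Suc N) g"
  shows "coeff_op c (weighted_poly \<alpha> (newton_poly b N g)) =
    weighted_poly \<alpha> (smult \<kappa> (newton_poly b N (\<lambda>x. g (x + 1))))"
proof
  fix z
  define a where "a = (\<lambda>j. (fdiff ^^ j) g 0)"
  have aN: "a (Suc N) = 0" using g unfolding a_def fdeg_less_def by metis
  have shift: "(fdiff ^^ j) (\<lambda>x. g (x + 1)) 0 = a j + a (Suc j)" for j
    unfolding fdiff_funpow_shift by (simp add: a_def fdiff_def)
  have "coeff_op c (weighted_poly \<alpha> (newton_poly b N g)) z =
      (\<Sum>j\<le>N. a j * coeff_op c (weighted_poly \<alpha> (b j)) z) + \<kappa> * a (Suc N) * weighted_poly \<alpha> (b N) z"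
    unfolding newton_poly_def coeff_op_weighted_poly_sum[OF c finite_atMost] aN by (simp add: a_def)
  also have "\<dots> = \<kappa> * (\<Sum>j\<le>N. (a j + a (Suc j)) * weighted_poly \<alpha> (b j) z)"
    by (rule sum_times_binomial_recurrence) (simp_all only: b weighted_poly_simps)
  also have "\<dots> = weighted_poly \<alpha> (smult \<kappa> (newton_poly b N (\<lambda>x. g (x + 1)))) z"
    unfolding newton_poly_def shift weighted_poly_simps ..
  finally show "coeff_op c (weighted_poly \<alpha> (newton_poly b N g)) z =
    weighted_poly \<alpha> (smult \<kappa> (newton_poly b N (\<lambda>x. g (x + 1)))) z" .
qed

lemma coeff_op_funpow_newton_poly:
  assumes c: "exp_bounded C A c"
    and b: "coeff_op c (weighted_poly \<alpha> (b 0)) = weighted_poly \<alpha> (smult \<kappa> (b 0))"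
      "\<And>j. coeff_op c (weighted_poly \<alpha> (b (Suc j))) = weighted_poly \<alpha> (smult \<kappa> (b (Suc j) + b j))"
    and g: "fdeg_less (Suc N) g"
  shows "(coeff_op c ^^ n) (weighted_poly \<alpha> (newton_poly b N g)) =
    weighted_poly \<alpha> (smult (\<kappa> ^ n) (newton_poly b N (\<lambda>x. g (x + of_nat n))))"
proof (induction n)
  case (Suc n)
  show ?case
  proof
    fix z
    have "(coeff_op c ^^ Suc n) (weighted_poly \<alpha> (newton_poly b N g)) z =
        \<kappa> ^ n * coeff_op c (weighted_poly \<alpha> (newton_poly b N (\<lambda>x. g (x + of_nat n)))) z"
      by (simp only: funpow.simps comp_apply Suc.IH coeff_op_weighted_poly_smult[OF c])
    also have "coeff_op c (weighted_poly \<alpha> (newton_poly b N (\<lambda>x. g (x + of_nat n)))) =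
        weighted_poly \<alpha> (smult \<kappa> (newton_poly b N (\<lambda>x. g (x + 1 + of_nat n))))"
      by (rule coeff_op_newton_poly[OF c b fdeg_less_shift[OF g]])
    finally show "(coeff_op c ^^ Suc n) (weighted_poly \<alpha> (newton_poly b N g)) z =
        weighted_poly \<alpha> (smult (\<kappa> ^ Suc n) (newton_poly b N (\<lambda>x. g (x + of_nat (Suc n))))) z"
      by (simp add: weighted_poly_simps algebra_simps)
  qed
qed simp

section \<open>Interpolating between two polynomials along a translation orbit\<close>

lemma one_minus_power_le:
  "\<exists>K. \<forall>u::complex. norm u \<le> 1 \<longrightarrow> norm (1 - (1 - u) ^ M) \<le> K * norm u"
proof (induction M)
  case (Suc M)
  then obtain K where K: "\<And>u::complex. norm u \<le> 1 \<Longrightarrow> norm (1 - (1 - u) ^ M) \<le> K * norm u" by blast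
  have "norm (1 - (1 - u) ^ Suc M) \<le> (K + 2 ^ M) * norm u" if u: "norm u \<le> 1" for u :: complex
  proof -
    have "1 - (1 - u) ^ Suc M = (1 - (1 - u) ^ M) + u * (1 - u) ^ M" by (simp add: algebra_simps)
    moreover have "norm (1 - u) \<le> 2" using norm_triangle_ineq4[of 1 u] u by simp
    then have "norm (u * (1 - u) ^ M) \<le> norm u * 2 ^ M"
      by (simp add: norm_mult norm_power mult_left_mono power_mono)
    ultimately show ?thesis
      using K[OF u] norm_triangle_ineq[of "1 - (1 - u) ^ M" "u * (1 - u) ^ M"]
      by (simp add: algebra_simps)
  qed
  then show ?case by blast
qed (auto intro: exI[of _ 0])

text \<open>A decay of order \<open>n^(-d-1)\<close> against a growth of order \<open>n^d\<close>
  leaves a factor \<open>1/n\<close>.\<close>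

lemma decay_beats_growth:
  fixes A G :: "nat \<Rightarrow> complex"
  assumes A: "eventually (\<lambda>n. norm (A n) \<le> K * (r / real n) ^ Suc d) sequentially"
    and G: "\<And>n. norm (G n) \<le> L * (1 + r + real n) ^ d"
  shows "(\<lambda>n. A n * G n) \<longlonglongrightarrow> 0"
proof (rule Lim_null_comparison)
  show "eventually (\<lambda>n. norm (A n * G n) \<le> K * L * r ^ Suc d * ((1 + r) / real n + 1) ^ d * (1 / real n)) sequentially"
    using A eventually_gt_at_top[of 0]
  proof eventually_elim
    case (elim n)
    have "norm (A n * G n) \<le> (K * (r / real n) ^ Suc d) * (L * (1 + r + real n) ^ d)"
      unfolding norm_mult using elim G[of n] norm_ge_zero[of "A n"] norm_ge_zero[of "G n"]
      by (intro mult_mono) linarith+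
    also have "(1 + r + real n) = ((1 + r) / real n + 1) * real n" using elim by (simp add: field_simps)
    also have "(K * (r / real n) ^ Suc d) * (L * (((1 + r) / real n + 1) * real n) ^ d) =
        K * L * r ^ Suc d * ((1 + r) / real n + 1) ^ d * (1 / real n)"
      unfolding power_mult_distrib power_divide using elim by (simp add: field_simps)
    finally show ?case .
  qed
  have "(\<lambda>n. K * L * r ^ Suc d * ((1 + r) / real n + 1) ^ d * (1 / real n)) \<longlonglongrightarrow> K * L * r ^ Suc d * (0 + 1) ^ d * 0"
    by (intro tendsto_intros lim_const_over_n lim_1_over_n)
  then show "(\<lambda>n. K * L * r ^ Suc d * ((1 + r) / real n + 1) ^ d * (1 / real n)) \<longlonglongrightarrow> 0" by simp
qed

text \<open>Supplies the growth hypothesis of \<open>decay_beats_growth\<close>, both for a second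
  polynomial translated back by \<open>n\<close> and for a first one translated forward.\<close>

lemma newton_sum_pair_bound:
  fixes k :: complex
  assumes "norm k = 1" "norm y \<le> r + real n" "norm x \<le> r + real n"
  shows "norm (k * newton_sum v d y - newton_sum u d x) \<le>
    ((\<Sum>j\<le>d. norm (v j)) + (\<Sum>j\<le>d. norm (u j))) * (1 + r + real n) ^ d"
proof -
  have le: "norm (newton_sum w d z) \<le> (\<Sum>j\<le>d. norm (w j)) * (1 + r + real n) ^ d"
    if "norm z \<le> r + real n" for w z
    using that by (intro order_trans[OF norm_newton_sum_le] mult_left_mono power_mono sum_nonneg) auto
  have "norm (k * newton_sum v d y - newton_sum u d x) \<le> norm (newton_sum v d y) + norm (newton_sum u d x)"
    using norm_triangle_ineq4[of "k * newton_sum v d y" "newton_sum u d x"] assms(1) by (simp add: norm_mult)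
  then show ?thesis using le[OF assms(2), of v] le[OF assms(3), of u] by (simp add: algebra_simps)
qed

text \<open>At \<open>n = 0\<close> the division by \<open>n\<close> in the proof yields \<open>H 0 = 0\<close>, so the operator identity
  holds there as well.\<close>

lemma approximation_step:
  assumes c: "exp_bounded C A c"
    and b: "coeff_op c (weighted_poly \<alpha> (b 0)) = weighted_poly \<alpha> (smult \<kappa> (b 0))"
      "\<And>j. coeff_op c (weighted_poly \<alpha> (b (Suc j))) = weighted_poly \<alpha> (smult \<kappa> (b (Suc j) + b j))"
    and \<kappa>: "norm \<kappa> = 1"
  shows "\<exists>N e \<epsilon>. (\<forall>j. (\<lambda>n. e n j) \<longlonglongrightarrow> 0) \<and> (\<forall>j. (\<lambda>n. \<epsilon> n j) \<longlonglongrightarrow> 0) \<and>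
    (\<forall>n. (coeff_op c ^^ n) (weighted_poly \<alpha> ((\<Sum>j\<le>d. smult (u j) (b j)) + (\<Sum>j\<le>N. smult (e n j) (b j)))) =
      weighted_poly \<alpha> ((\<Sum>j\<le>d. smult (v j) (b j)) + (\<Sum>j\<le>N. smult (\<epsilon> n j) (b j))))"
proof -
  \<comment> \<open>An order of vanishing one above \<open>d\<close> beats growth of degree
    \<open>d\<close>. As \<open>H\<close> below has degree \<open>M * M\<close>, all
    \<open>p n\<close> have degree at most \<open>N\<close>, independently of
    \<open>n\<close>.\<close>
  define M where "M = Suc d"
  define N where "N = M * M + d"
  define F where "F = newton_sum u d"
  define Q where "Q = newton_sum v d"
  \<comment> \<open>Compensates the factor \<open>\<kappa>^n\<close> that \<open>n\<close>
    applications of the operator produce.\<close>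
  define l where "l = (\<lambda>n::nat. inverse (\<kappa> ^ n))"
  \<comment> \<open>\<open>H\<close> vanishes to order \<open>M\<close> at 0, and
    \<open>1 - H = (1 - w^M)^M\<close> does so at 1. For fixed \<open>x\<close>, the arguments
    \<open>x/n\<close> and \<open>(x + n)/n\<close> tend to these two points.\<close>
  define H where "H = (\<lambda>w::complex. 1 - (1 - w ^ M) ^ M)"
  define p where "p = (\<lambda>n x. H (x / of_nat n) * (l n * Q (x - of_nat n) - F x))"
  define G where "G = (\<lambda>n x. F (x + of_nat n) + p n (x + of_nat n))"
  have l: "norm (l n) = 1" "\<kappa> ^ n * l n = 1" for n
  proof -
    have "\<kappa> \<noteq> 0" using \<kappa> by auto
    then show "norm (l n) = 1" "\<kappa> ^ n * l n = 1"
      using \<kappa> by (simp_all add: l_def norm_inverse norm_power)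
  qed
  have degF: "fdeg_less (Suc d) F" and degQ: "fdeg_less (Suc d) Q"
    unfolding F_def Q_def by (rule fdeg_less_newton_sum)+
  have degp: "fdeg_less (Suc N) (p n)" for n
  proof -
    have "fdeg_less (Suc 1) (\<lambda>x. x / of_nat n)" using fdeg_less_linear by (simp add: numeral_2_eq_2)
    from fdeg_less_power[OF this, of M]
    have "fdeg_less (Suc M) (\<lambda>x. (x / of_nat n) ^ M)" by simp
    from fdeg_less_power[OF fdeg_less_diff[OF fdeg_less_const this], of M]
    have "fdeg_less (Suc (M * M)) (\<lambda>x. H (x / of_nat n))"
      unfolding H_def by (intro fdeg_less_diff fdeg_less_const)
    moreover have "fdeg_less (Suc d) (\<lambda>x. l n * Q (x - of_nat n) - F x)"
      using fdeg_less_shift[OF degQ, of "- of_nat n"] degF by (intro fdeg_less_diff fdeg_less_cmult) auto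
    ultimately show ?thesis unfolding N_def p_def by (rule fdeg_less_mult)
  qed
  obtain K where K: "\<And>w::complex. norm w \<le> 1 \<Longrightarrow> norm (1 - (1 - w) ^ M) \<le> K * norm w"
    using one_minus_power_le[of M] by blast
  have small: "eventually (\<lambda>n. norm (x / of_nat n) \<le> 1 \<and> n > 0) sequentially" for x :: complex
  proof -
    obtain m :: nat where m: "norm x \<le> real m" using real_arch_simple by blast
    show ?thesis using eventually_ge_at_top[of "Suc m"]
      by eventually_elim (use m in \<open>auto simp: norm_divide divide_le_eq\<close>)
  qed
  have p_lim: "(\<lambda>n. p n x) \<longlonglongrightarrow> 0" for x
    unfolding p_def
  proof (rule decay_beats_growth)
    show "eventually (\<lambda>n. norm (H (x / of_nat n)) \<le> K * (norm x / real n) ^ Suc d) sequentially"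
      using small[of x]
    proof eventually_elim
      case (elim n)
      then have "norm ((x / of_nat n) ^ M) \<le> 1" by (simp add: norm_power power_le_one del: power_Suc)
      from K[OF this] show ?case by (simp only: H_def M_def norm_power norm_divide norm_of_nat)
    qed
    show "norm (l n * Q (x - of_nat n) - F x) \<le>
      ((\<Sum>j\<le>d. norm (v j)) + (\<Sum>j\<le>d. norm (u j))) * (1 + norm x + real n) ^ d" for n
      unfolding Q_def F_def
      by (rule newton_sum_pair_bound[OF l(1)]) (use norm_triangle_ineq4[of x "of_nat n"] in auto)
  qed
  have G_lim: "(\<lambda>n. G n x - l n * Q x) \<longlonglongrightarrow> 0" for x
  proof -
    \<comment> \<open>The first factor is \<open>H - 1\<close> at \<open>(x + n)/n\<close>.\<close>
    have eq: "G n x - l n * Q x = - ((1 - ((x + of_nat n) / of_nat n) ^ M) ^ M) * (l n * Q x - F (x + of_nat n))" for n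
      by (simp add: G_def p_def H_def algebra_simps)
    show ?thesis unfolding eq
    proof (rule decay_beats_growth)
      show "eventually (\<lambda>n. norm (- ((1 - ((x + of_nat n) / of_nat n) ^ M) ^ M)) \<le>
          K ^ M * (norm x / real n) ^ Suc d) sequentially"
        \<comment> \<open>Here \<open>(x + n)/n = 1 - u\<close> with \<open>u = -x/n\<close>, so
          \<open>K\<close> bounds \<open>1 - (1 - u)^M\<close> linearly in \<open>|u|\<close>; the
          \<open>M\<close>-th power of this gives the required order.\<close>
        using small[of "- x"]
      proof eventually_elim
        case (elim n)
        have "(x + of_nat n) / of_nat n = 1 - (- x / of_nat n)" using elim by (simp add: field_simps)
        moreover have "norm (- x / of_nat n) \<le> 1" using elim by simp
        ultimately have "norm (1 - ((x + of_nat n) / of_nat n) ^ M) \<le> K * norm (- x / of_nat n)"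
          using K by metis
        then have "norm (1 - ((x + of_nat n) / of_nat n) ^ M) \<le> K * (norm x / real n)"
          by (simp add: norm_divide)
        then have "norm (1 - ((x + of_nat n) / of_nat n) ^ M) ^ M \<le> (K * (norm x / real n)) ^ M"
          by (rule power_mono) simp
        then show ?case by (simp only: norm_minus_cancel norm_power power_mult_distrib M_def)
      qed
      show "norm (l n * Q x - F (x + of_nat n)) \<le>
        ((\<Sum>j\<le>d. norm (v j)) + (\<Sum>j\<le>d. norm (u j))) * (1 + norm x + real n) ^ d" for n
        unfolding Q_def F_def
        by (rule newton_sum_pair_bound[OF l(1)]) (use norm_triangle_ineq[of x "of_nat n"] in auto)
    qed
  qed
  \<comment> \<open>\<open>e\<close> holds the Newton coefficients of the correction, and
    \<open>\<epsilon>\<close> those of the remaining error after \<open>n\<close> applications. As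
    \<open>\<kappa>\<close> has modulus one, the factor \<open>\<kappa>^n\<close> does not spoil
    convergence to 0.\<close>
  define e where "e = (\<lambda>n j. (fdiff ^^ j) (p n) 0)"
  define \<epsilon> where "\<epsilon> = (\<lambda>n j. \<kappa> ^ n * (fdiff ^^ j) (\<lambda>x. G n x - l n * Q x) 0)"
  have "(\<lambda>n. e n j) \<longlonglongrightarrow> 0" for j
    unfolding e_def by (rule fdiff_funpow_tendsto_0[OF p_lim])
  moreover have "(\<lambda>n. \<epsilon> n j) \<longlonglongrightarrow> 0" for j
  proof (rule tendsto_norm_zero_cancel)
    have "(\<lambda>n. norm ((fdiff ^^ j) (\<lambda>x. G n x - l n * Q x) 0)) \<longlonglongrightarrow> 0"
      by (rule tendsto_norm_zero[OF fdiff_funpow_tendsto_0[OF G_lim]])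
    then show "(\<lambda>n. norm (\<epsilon> n j)) \<longlonglongrightarrow> 0" using \<kappa> by (simp add: \<epsilon>_def norm_mult norm_power)
  qed
  moreover have "(coeff_op c ^^ n) (weighted_poly \<alpha> ((\<Sum>j\<le>d. smult (u j) (b j)) + (\<Sum>j\<le>N. smult (e n j) (b j)))) =
      weighted_poly \<alpha> ((\<Sum>j\<le>d. smult (v j) (b j)) + (\<Sum>j\<le>N. smult (\<epsilon> n j) (b j)))" for n
  proof -
    have dN: "d \<le> N" by (simp add: N_def)
    have F: "(\<Sum>j\<le>d. smult (u j) (b j)) = newton_poly b N F"
      unfolding F_def by (rule newton_poly_newton_sum[OF dN, symmetric])
    have Q: "(\<Sum>j\<le>d. smult (v j) (b j)) = newton_poly b N Q"
      unfolding Q_def by (rule newton_poly_newton_sum[OF dN, symmetric])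
    have P: "(\<Sum>j\<le>N. smult (e n j) (b j)) = newton_poly b N (p n)"
      unfolding e_def newton_poly_def ..
    have E: "(\<Sum>j\<le>N. smult (\<epsilon> n j) (b j)) = smult (\<kappa> ^ n) (newton_poly b N (\<lambda>x. G n x - l n * Q x))"
      unfolding \<epsilon>_def newton_poly_def by (simp add: smult_sum_right)
    have "fdeg_less (Suc N) (\<lambda>x. F x + p n x)"
      using degF degp dN by (intro fdeg_less_add) (auto intro: fdeg_less_mono)
    from coeff_op_funpow_newton_poly[where b = b, OF c b this, of n]
    have "(coeff_op c ^^ n) (weighted_poly \<alpha> (newton_poly b N F + newton_poly b N (p n))) =
        weighted_poly \<alpha> (smult (\<kappa> ^ n) (newton_poly b N (G n)))"
      unfolding newton_poly_add[symmetric] G_def .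
    also have "smult (\<kappa> ^ n) (newton_poly b N (G n)) =
        smult (\<kappa> ^ n) (newton_poly b N (\<lambda>x. l n * Q x + (G n x - l n * Q x)))" by simp
    also have "\<dots> = newton_poly b N Q + smult (\<kappa> ^ n) (newton_poly b N (\<lambda>x. G n x - l n * Q x))"
      unfolding newton_poly_add newton_poly_cmult smult_add_right smult_smult l(2) by simp
    finally show ?thesis unfolding F Q P E .
  qed
  ultimately show ?thesis by blast
qed

section \<open>Small perturbations under a growth bound\<close>

lemma poly_growth:
  fixes P :: "complex poly" and q :: "real \<Rightarrow> real"
  assumes "filterlim q at_top at_top"
  shows "\<exists>K\<ge>0. \<forall>z. norm (poly P z) \<le> K * max 1 (norm z powr q (norm z))"
proof -
  define d where "d = degree P"
  define S where "S = (\<Sum>i\<le>d. norm (coeff P i))"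
  have S: "S \<ge> 0" unfolding S_def by (intro sum_nonneg) simp
  \<comment> \<open>Beyond \<open>R\<close> the exponent \<open>q\<close> is at least the degree, so
    the power dominates; inside, the constant \<open>R^d\<close> and the maximum with 1
    suffice.\<close>
  obtain R where R: "R \<ge> 1" "\<And>r. r \<ge> R \<Longrightarrow> q r \<ge> real d"
  proof -
    obtain R0 where "\<And>r. r \<ge> R0 \<Longrightarrow> q r \<ge> real d"
      using assms unfolding filterlim_at_top eventually_at_top_linorder by blast
    then show ?thesis using that[of "max 1 R0"] by auto
  qed
  have "norm (poly P z) \<le> (S * R ^ d) * max 1 (norm z powr q (norm z))" for z
  proof -
    have "norm (poly P z) \<le> (\<Sum>i\<le>d. norm (coeff P i) * max 1 (norm z) ^ d)"
      unfolding poly_altdef d_def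
    proof (rule sum_norm_le)
      fix i assume i: "i \<in> {..degree P}"
      have "norm z ^ i \<le> max 1 (norm z) ^ i" by (intro power_mono) auto
      also have "\<dots> \<le> max 1 (norm z) ^ degree P" using i by (intro power_increasing) auto
      finally show "norm (coeff P i * z ^ i) \<le> norm (coeff P i) * max 1 (norm z) ^ degree P"
        by (simp add: norm_mult norm_power mult_left_mono)
    qed
    also have "\<dots> = S * max 1 (norm z) ^ d" by (simp add: S_def sum_distrib_right)
    also have "max 1 (norm z) ^ d \<le> R ^ d * max 1 (norm z powr q (norm z))"
    proof (cases "norm z \<ge> R")
      case True
      then have z: "norm z \<ge> 1" using R(1) by simp
      have "norm z > 0" using z by linarith
      then have "max 1 (norm z) ^ d = norm z powr real d" using z by (simp add: powr_realpow max_absorb2)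
      also have "\<dots> \<le> norm z powr q (norm z)" using z R(2)[OF True] by (intro powr_mono) auto
      also have "\<dots> \<le> 1 * max 1 (norm z powr q (norm z))" by simp
      also have "\<dots> \<le> R ^ d * max 1 (norm z powr q (norm z))"
        using R(1) by (intro mult_right_mono one_le_power) auto
      finally show ?thesis .
    next
      case False
      then have "max 1 (norm z) ^ d \<le> R ^ d * 1" using R(1) by (simp, intro power_mono) auto
      also have "\<dots> \<le> R ^ d * max 1 (norm z powr q (norm z))" using R(1) by (intro mult_left_mono) auto
      finally show ?thesis .
    qed
    finally show ?thesis using S by (simp add: mult_left_mono mult.assoc)
  qed
  then show ?thesis using S R(1) by (intro exI[of _ "S * R ^ d"]) auto
qed

text \<open>The corrections lie in the span of \<open>b 0, ..., b N\<close> with \<open>N\<close>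
  independent of \<open>n\<close>, and their coefficients tend to 0. Hence the size relative to
  \<open>g\<close>, the size on the disc and the orbit error are all bounded by finite sums tending
  to 0, and one large \<open>n\<close> serves all three.\<close>

lemma small_perturbation_exists:
  assumes c: "exp_bounded C A c"
    and b: "\<And>j. degree (b j) = j" "\<And>j. b j \<noteq> 0"
      "coeff_op c (weighted_poly \<alpha> (b 0)) = weighted_poly \<alpha> (smult \<kappa> (b 0))"
      "\<And>j. coeff_op c (weighted_poly \<alpha> (b (Suc j))) = weighted_poly \<alpha> (smult \<kappa> (b (Suc j) + b j))"
    and \<kappa>: "norm \<kappa> = 1"
    and g: "\<And>P. \<exists>K\<ge>0. \<forall>z. norm (poly P z) \<le> K * g z"  "\<And>z. g z \<ge> (0::real)"
    and \<delta>: "\<delta> > 0"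
  shows "\<exists>n P. n \<ge> n0 \<and> (\<forall>z. norm (poly P z) \<le> \<delta> * g z) \<and>
    (\<forall>z. norm z \<le> \<rho> \<longrightarrow> norm (weighted_poly \<alpha> P z) \<le> \<delta>) \<and>
    (\<forall>z. norm z \<le> \<rho> \<longrightarrow> norm ((coeff_op c ^^ n) (weighted_poly \<alpha> (F + P)) z - weighted_poly \<alpha> Q z) \<le> \<delta>)"
proof -
  define d where "d = max (degree F) (degree Q)"
  have "coeff F i = 0" "coeff Q i = 0" if "i \<ge> Suc d" for i
    using that by (auto simp: d_def coeff_eq_0)
  then obtain u v where u: "F = (\<Sum>j\<le>d. smult (u j) (b j))" and v: "Q = (\<Sum>j\<le>d. smult (v j) (b j))"
    using graded_basis_spans[OF b(1,2), of "Suc d" F] graded_basis_spans[OF b(1,2), of "Suc d" Q]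
    unfolding lessThan_Suc_atMost by blast
  obtain N e \<epsilon> where e: "\<And>j. (\<lambda>n. e n j) \<longlonglongrightarrow> 0" and \<epsilon>: "\<And>j. (\<lambda>n. \<epsilon> n j) \<longlonglongrightarrow> 0"
    and eq: "\<And>n. (coeff_op c ^^ n) (weighted_poly \<alpha> (F + (\<Sum>j\<le>N. smult (e n j) (b j)))) =
      weighted_poly \<alpha> (Q + (\<Sum>j\<le>N. smult (\<epsilon> n j) (b j)))"
    using approximation_step[where b = b and d = d and u = u and v = v, OF c b(3,4) \<kappa>] unfolding u[symmetric] v[symmetric] by blast
  have "\<forall>j. \<exists>K\<ge>0. \<forall>z. norm (poly (b j) z) \<le> K * g z" using g(1) by blast
  then obtain K where K: "\<And>j. K j \<ge> 0" "\<And>j z. norm (poly (b j) z) \<le> K j * g z" by metis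
  have "\<forall>j. \<exists>M. \<forall>z. norm z \<le> \<rho> \<longrightarrow> norm (weighted_poly \<alpha> (b j) z) \<le> M"
    using entire_bounded_on_cball[OF weighted_poly_holomorphic] by metis
  then obtain M where M: "\<And>j z. norm z \<le> \<rho> \<Longrightarrow> norm (weighted_poly \<alpha> (b j) z) \<le> M j" by metis
  have small: "eventually (\<lambda>n. (\<Sum>j\<le>N. norm (a n j) * L j) < \<delta>) sequentially"
    if "\<And>j. (\<lambda>n. a n j) \<longlonglongrightarrow> 0" for a :: "nat \<Rightarrow> nat \<Rightarrow> complex" and L :: "nat \<Rightarrow> real"
  proof -
    have "(\<lambda>n. \<Sum>j\<le>N. norm (a n j) * L j) \<longlonglongrightarrow> (\<Sum>j\<le>N. 0 * L j)"
      by (intro tendsto_sum tendsto_mult_right tendsto_norm_zero that)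
    then show ?thesis using \<delta> by (intro order_tendstoD) auto
  qed
  obtain n where n: "n \<ge> n0" "(\<Sum>j\<le>N. norm (e n j) * K j) < \<delta>"
      "(\<Sum>j\<le>N. norm (e n j) * M j) < \<delta>" "(\<Sum>j\<le>N. norm (\<epsilon> n j) * M j) < \<delta>"
    using eventually_happens[OF eventually_conj[OF eventually_ge_at_top[of n0]
      eventually_conj[OF small[where a = e and L = K, OF e] eventually_conj[OF small[where a = e and L = M, OF e] small[where a = \<epsilon> and L = M, OF \<epsilon>]]]]]
    by auto
  define P where "P = (\<Sum>j\<le>N. smult (e n j) (b j))"
  have wp: "norm (weighted_poly \<alpha> (\<Sum>j\<le>N. smult (a j) (b j)) z) \<le> (\<Sum>j\<le>N. norm (a j) * M j)"
    if "norm z \<le> \<rho>" for a z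
    unfolding weighted_poly_simps by (rule sum_norm_le) (simp add: norm_mult mult_left_mono M[OF that])
  have "norm (poly P z) \<le> \<delta> * g z" for z
  proof -
    have "norm (poly P z) \<le> (\<Sum>j\<le>N. norm (e n j) * (K j * g z))"
      unfolding P_def poly_sum poly_smult by (rule sum_norm_le) (simp add: norm_mult mult_left_mono K(2))
    also have "\<dots> = (\<Sum>j\<le>N. norm (e n j) * K j) * g z" by (simp add: sum_distrib_right mult.assoc)
    also have "\<dots> \<le> \<delta> * g z" using n(2) g(2) by (intro mult_right_mono) auto
    finally show ?thesis .
  qed
  moreover have "norm (weighted_poly \<alpha> P z) \<le> \<delta>" if "norm z \<le> \<rho>" for z
    using wp[OF that, of "e n"] n(3) by (simp add: P_def)
  moreover have "norm ((coeff_op c ^^ n) (weighted_poly \<alpha> (F + P)) z - weighted_poly \<alpha> Q z) \<le> \<delta>"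
    if "norm z \<le> \<rho>" for z
    using wp[OF that, of "\<epsilon> n"] n(4) unfolding P_def eq weighted_poly_simps(2) by simp
  ultimately show ?thesis using n(1) by blast
qed

lemma geometric_tail_norm_le:
  fixes h :: "nat \<Rightarrow> complex"
  assumes "\<And>i. i \<ge> m \<Longrightarrow> norm (h i) \<le> (1 / 2) ^ i * L"
  shows "summable h" "norm (suminf h - (\<Sum>i<m. h i)) \<le> 2 * (1 / 2) ^ m * L"
proof -
  have G: "summable (\<lambda>i. (1 / 2) ^ i * L :: real)" by (intro summable_mult2) simp
  show S: "summable h" by (rule summable_comparison_test'[OF G assms])
  have G': "summable (\<lambda>i. (1 / 2) ^ (i + m) * L :: real)" using G by (subst summable_iff_shift)
  have "norm (\<Sum>i. h (i + m)) \<le> (\<Sum>i. (1 / 2) ^ (i + m) * L)"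
    by (rule norm_suminf_le[OF _ G']) (simp add: assms)
  also have "\<dots> = (\<Sum>i. ((1 / 2) ^ m * L) * (1 / 2) ^ i)" by (simp add: power_add mult_ac)
  also have "\<dots> = 2 * (1 / 2) ^ m * L" by (subst suminf_mult) (simp_all add: suminf_geometric)
  finally show "norm (suminf h - (\<Sum>i<m. h i)) \<le> 2 * (1 / 2) ^ m * L"
    using suminf_minus_initial_segment[OF S, of m] by simp
qed

section \<open>Construction of the hypercyclic vector\<close>

text \<open>The bound \<open>(1/2)\<^sup>k / B\<^sup>n\<close> on the disc of radius \<open>k + 2 A n\<close> in the recursion is what remains small
  after \<open>n\<close> applications of the operator, each of which costs a factor \<open>2 C\<close> and a radius \<open>2 A\<close>.\<close>

lemma slow_growth_approximating_orbit:
  fixes Qs :: "nat \<Rightarrow> complex poly"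
  assumes c: "exp_bounded C A c"
    and b: "\<And>j. degree (b j) = j" "\<And>j. b j \<noteq> 0"
      "coeff_op c (weighted_poly \<alpha> (b 0)) = weighted_poly \<alpha> (smult \<kappa> (b 0))"
      "\<And>j. coeff_op c (weighted_poly \<alpha> (b (Suc j))) = weighted_poly \<alpha> (smult \<kappa> (b (Suc j) + b j))"
    and \<kappa>: "norm \<kappa> = 1"
    and g: "\<And>P. \<exists>K\<ge>0. \<forall>z. norm (poly P z) \<le> K * g z"  "\<And>z. g z \<ge> (0::real)"
  shows "\<exists>f. f holomorphic_on UNIV \<and> (\<forall>z. norm (f z) \<le> 2 * g z) \<and>
    (\<forall>k. \<exists>n. \<forall>z. norm z \<le> real k \<longrightarrow>
      norm ((coeff_op c ^^ n) (\<lambda>z. f z * exp_fun \<alpha> z) z - weighted_poly \<alpha> (Qs k) z) \<le> 2 * (1 / 2) ^ k)"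
proof -
  let ?T = "coeff_op c" and ?w = "weighted_poly \<alpha>"
  \<comment> \<open>\<open>B\<close> dominates the cost \<open>2 * C\<close> of one application, and
    \<open>B \<ge> 1\<close> makes \<open>1 / B^n\<close> decrease in \<open>n\<close>.\<close>
  define B where "B = max 1 (2 * C)"
  have B: "B \<ge> 1" "2 * C \<le> B" and A: "A > 0" and C: "C > 0"
    using c by (auto simp: B_def exp_bounded_def)
  \<comment> \<open>A state consists of the iteration count and the polynomial reached so far. The
    next correction must be negligible after the old count of iterations, while the new count brings
    the orbit close to \<open>Qs k\<close>.\<close>
  define rel where "rel = (\<lambda>k s s'. fst s \<le> fst s' \<and>
    (\<forall>z. norm (poly (snd s' - snd s) z) \<le> (1 / 2) ^ k * g z) \<and>
    (\<forall>z. norm z \<le> real k + 2 * A * real (fst s) \<longrightarrow> norm (?w (snd s' - snd s) z) \<le> (1 / 2) ^ k / B ^ fst s) \<and>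
    (\<forall>z. norm z \<le> real k \<longrightarrow> norm ((?T ^^ fst s') (?w (snd s')) z - ?w (Qs k) z) \<le> (1 / 2) ^ k))"
  have "\<exists>s. \<forall>k. (k = 0 \<longrightarrow> s k = (0 :: nat, 0 :: complex poly)) \<and> rel k (s k) (s (Suc k))"
  proof (rule dependent_nat_choice[where P = "\<lambda>k s. k = 0 \<longrightarrow> s = (0, 0)" and Q = rel])
    fix s :: "nat \<times> complex poly" and k
    \<comment> \<open>The smaller of the two tolerances in \<open>rel\<close>, so that one
      perturbation meets all conditions.\<close>
    define \<delta> where "\<delta> = (1 / 2) ^ k / B ^ fst s"
    have \<delta>: "\<delta> > 0" "\<delta> \<le> (1 / 2) ^ k" using B(1) by (auto simp: \<delta>_def divide_le_eq)
    define \<rho> where "\<rho> = real k + 2 * A * real (fst s)"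
    have \<rho>: "\<rho> \<ge> real k" using A by (simp add: \<rho>_def)
    obtain n P where P: "n \<ge> fst s" "\<And>z. norm (poly P z) \<le> \<delta> * g z"
      "\<And>z. norm z \<le> \<rho> \<Longrightarrow> norm (?w P z) \<le> \<delta>"
      "\<And>z. norm z \<le> \<rho> \<Longrightarrow> norm ((?T ^^ n) (?w (snd s + P)) z - ?w (Qs k) z) \<le> \<delta>"
      using small_perturbation_exists[where b = b and g = g, OF c b \<kappa> g \<delta>(1), of "fst s" \<rho> "snd s" "Qs k"] by blast
    have "rel k s (n, snd s + P)"
      unfolding rel_def
    proof (intro conjI allI impI)
      show "norm (poly (snd (n, snd s + P) - snd s) z) \<le> (1 / 2) ^ k * g z" for z
        using P(2)[of z] mult_right_mono[OF \<delta>(2) g(2), of z] by simp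
      show "norm (?w (snd (n, snd s + P) - snd s) z) \<le> (1 / 2) ^ k / B ^ fst s"
        if "norm z \<le> real k + 2 * A * real (fst s)" for z
        using P(3)[of z] that by (simp add: \<rho>_def \<delta>_def)
      show "norm ((?T ^^ fst (n, snd s + P)) (?w (snd (n, snd s + P))) z - ?w (Qs k) z) \<le> (1 / 2) ^ k"
        if "norm z \<le> real k" for z
        using P(4)[of z] that \<rho> \<delta>(2) by simp
    qed (use P(1) in simp)
    then show "\<exists>s'. (Suc k = 0 \<longrightarrow> s' = (0, 0)) \<and> rel k s s'" by blast
  qed simp
  then obtain s where s0: "s 0 = (0, 0)" and s: "\<And>k. rel k (s k) (s (Suc k))" by blast
  define n where "n = (\<lambda>k. fst (s k))"
  define P where "P = (\<lambda>k. snd (s (Suc k)) - snd (s k))"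
  have n_mono: "mono n" unfolding mono_iff_le_Suc using s by (auto simp: rel_def n_def)
  have P_growth: "norm (poly (P k) z) \<le> (1 / 2) ^ k * g z" for k z
    using s[of k] by (simp add: rel_def P_def)
  have P_small: "norm (?w (P k) z) \<le> (1 / 2) ^ k * (1 / B ^ n k)" if "norm z \<le> real k + 2 * A * real (n k)" for k z
    using s[of k] that by (simp add: rel_def P_def n_def)
  have orbit: "norm ((?T ^^ n (Suc k)) (?w (snd (s (Suc k)))) z - ?w (Qs k) z) \<le> (1 / 2) ^ k"
    if "norm z \<le> real k" for k z
    using s[of k] that by (simp add: rel_def n_def)
  have sum_P: "(\<Sum>i<k. P i) = snd (s k)" for k
    unfolding P_def using sum_lessThan_telescope[of "\<lambda>i. snd (s i)" k] by (simp add: s0)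
  \<comment> \<open>Corrections from step \<open>k\<close> on inherit the bound of step
    \<open>k\<close>: the discs grow and \<open>1 / B^n\<close> decreases, because the counts are
    monotone.\<close>
  have P_small': "norm (?w (P i) z) \<le> (1 / 2) ^ i * (1 / B ^ n k)"
    if "k \<le> i" "norm z \<le> real k + 2 * A * real (n k)" for i k z
  proof -
    have "n k \<le> n i" using monoD[OF n_mono that(1)] .
    then have "real k + 2 * A * real (n k) \<le> real i + 2 * A * real (n i)"
      using that(1) A by (intro add_mono mult_left_mono) auto
    with that have "norm (?w (P i) z) \<le> (1 / 2) ^ i * (1 / B ^ n i)" by (intro P_small) simp
    also have "\<dots> \<le> (1 / 2) ^ i * (1 / B ^ n k)"
      using B(1) \<open>n k \<le> n i\<close> by (intro mult_left_mono divide_left_mono power_increasing) auto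
    finally show ?thesis .
  qed
  define f where "f = (\<lambda>z. \<Sum>k. poly (P k) z)"
  define F where "F = (\<lambda>z. f z * exp_fun \<alpha> z)"
  have f_growth: "norm (f z) \<le> 2 * g z" for z
    using geometric_tail_norm_le(2)[of 0 "\<lambda>k. poly (P k) z" "g z"] P_growth by (simp add: f_def)
  have F_eq: "F z = (\<Sum>k. ?w (P k) z)" for z
    unfolding F_def f_def weighted_poly_def
    by (rule suminf_mult2, rule geometric_tail_norm_le(1)[of 0 _ "g z"]) (rule P_growth)
  have tail: "norm (F z - ?w (snd (s k)) z) \<le> 2 * (1 / 2) ^ k * (1 / B ^ n k)"
    if "norm z \<le> real k + 2 * A * real (n k)" for k z
    using geometric_tail_norm_le(2)[of k "\<lambda>i. ?w (P i) z" "1 / B ^ n k"] P_small'[OF _ that]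
    unfolding F_eq sum_P[symmetric] weighted_poly_simps(5) by blast
  have F_hol: "F holomorphic_on UNIV"
  proof -
    have "F holomorphic_on ball 0 r" for r
    proof -
      have ulim: "uniform_limit (cball 0 r) (\<lambda>k. ?w (snd (s k))) F sequentially"
      proof (rule uniform_limitI)
        fix e :: real assume "e > 0"
        have "(\<lambda>k. 2 * (1 / 2) ^ k :: real) \<longlonglongrightarrow> 2 * 0"
          by (intro tendsto_mult_left LIMSEQ_power_zero) simp
        then have "eventually (\<lambda>k. 2 * (1 / 2) ^ k < e) sequentially"
          using \<open>e > 0\<close> by (intro order_tendstoD) auto
        moreover have "eventually (\<lambda>k. r \<le> real k) sequentially"
          using eventually_ge_at_top[of "nat \<lceil>r\<rceil>"] by eventually_elim linarith
        ultimately show "eventually (\<lambda>k. \<forall>z\<in>cball 0 r. dist (?w (snd (s k)) z) (F z) < e) sequentially"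
        proof eventually_elim
          case (elim k)
          show ?case
          proof
            fix z :: complex assume "z \<in> cball 0 r"
            then have "norm z \<le> real k + 2 * A * real (n k)" using elim A by (simp add: add_increasing2)
            from tail[OF this] have "norm (F z - ?w (snd (s k)) z) \<le> 2 * (1 / 2) ^ k * (1 / B ^ n k)" .
            also have "\<dots> \<le> 2 * (1 / 2) ^ k * 1"
              using B(1) by (intro mult_left_mono) (auto simp: divide_le_eq)
            also have "\<dots> < e" using elim by simp
            finally show "dist (?w (snd (s k)) z) (F z) < e" by (simp add: dist_norm norm_minus_commute)
          qed
        qed
      qed
      show ?thesis
        by (rule holomorphic_uniform_limit[OF _ ulim])
          (intro always_eventually allI conjI holomorphic_on_imp_continuous_on weighted_poly_holomorphic, simp)
    qed
    then have "F field_differentiable at z" for z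
      using holomorphic_on_imp_differentiable_at[of F "ball 0 (norm z + 1)" z]
      by (auto simp: add_nonneg_pos)
    then show ?thesis by (simp add: holomorphic_on_def)
  qed
  \<comment> \<open>Holomorphy of \<open>f\<close> is recovered from \<open>F\<close>, since the
    bound by \<open>g\<close> controls the series of \<open>f\<close> only pointwise.\<close>
  have "f = (\<lambda>z. F z * exp_fun (- \<alpha>) z)"
    by (rule ext) (simp add: F_def exp_fun_def flip: exp_add mult.assoc)
  then have f_hol: "f holomorphic_on UNIV" using F_hol by (auto intro: holomorphic_intros)
  have "norm ((?T ^^ n (Suc k)) F z - ?w (Qs k) z) \<le> 2 * (1 / 2) ^ k" if z: "norm z \<le> real k" for k z
  proof -
    define W where "W = ?w (snd (s (Suc k)))"
    have W: "W holomorphic_on UNIV" unfolding W_def by (rule weighted_poly_holomorphic)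
    have U: "(\<lambda>z. F z - W z) holomorphic_on UNIV" using F_hol W by (intro holomorphic_intros)
    \<comment> \<open>The tail bound at index \<open>Suc k\<close> covers the radius
      \<open>k + 2 * A * n (Suc k)\<close> that these iterations consume, and its factor
      \<open>1 / B^n\<close> absorbs \<open>(2 * C)^n\<close>.\<close>
    have "norm ((?T ^^ n (Suc k)) (\<lambda>z. F z - W z) z) \<le> (2 * C) ^ n (Suc k) * (2 * (1 / 2) ^ Suc k * (1 / B ^ n (Suc k)))"
      by (rule coeff_op_funpow_norm_le[OF c U _ z]) (use tail[of _ "Suc k"] in \<open>simp add: W_def\<close>)
    also have "\<dots> = (1 / 2) ^ k * ((2 * C) ^ n (Suc k) / B ^ n (Suc k))" by simp
    also have "\<dots> \<le> (1 / 2) ^ k * 1"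
      using B C power_mono[of "2 * C" B "n (Suc k)"] by (intro mult_left_mono) (auto simp: divide_le_eq)
    finally have 1: "norm ((?T ^^ n (Suc k)) (\<lambda>z. F z - W z) z) \<le> (1 / 2) ^ k" by simp
    have "(?T ^^ n (Suc k)) F = (?T ^^ n (Suc k)) (\<lambda>z. W z + (F z - W z))" by simp
    also have "\<dots> = (\<lambda>z. (?T ^^ n (Suc k)) W z + (?T ^^ n (Suc k)) (\<lambda>z. F z - W z) z)"
      by (rule coeff_op_funpow_add[OF c W U])
    finally have "(?T ^^ n (Suc k)) F z - ?w (Qs k) z =
        ((?T ^^ n (Suc k)) W z - ?w (Qs k) z) + (?T ^^ n (Suc k)) (\<lambda>z. F z - W z) z" by simp
    then show ?thesis
      using 1 orbit[OF z] norm_triangle_ineq[of "(?T ^^ n (Suc k)) W z - ?w (Qs k) z"] unfolding W_def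
      by (smt (verit))
  qed
  then show ?thesis using f_hol f_growth unfolding F_def by blast
qed

section \<open>A sequence of polynomial targets\<close>

lemma entire_poly_approximation:
  assumes h: "h holomorphic_on UNIV" and D: "\<And>X. open X \<Longrightarrow> X \<noteq> {} \<Longrightarrow> \<exists>d\<in>D. d \<in> X" and e: "e > 0"
  shows "\<exists>ds\<in>lists D. \<forall>z::complex. norm z \<le> r \<longrightarrow> norm (poly (\<Sum>i<length ds. monom (ds ! i) i) z - h z :: complex) < e"
proof -
  define R where "R = max 1 r"
  have R: "R \<ge> 1" by (simp add: R_def)
  \<comment> \<open>Cauchy estimates on radius \<open>2 * R\<close> make the Taylor series converge
    geometrically on radius \<open>R\<close>.\<close>
  obtain M where M: "\<And>w. norm w \<le> 2 * R \<Longrightarrow> norm (h w) \<le> M"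
    using entire_bounded_on_cball[OF h] by metis
  define a where "a = (\<lambda>n. (deriv ^^ n) h 0 / fact n)"
  have hol: "h holomorphic_on S" for S using h holomorphic_on_subset by blast
  have an: "norm (a n) \<le> M / (2 * R) ^ n" for n
  proof -
    have "norm ((deriv ^^ n) h 0) \<le> fact n * M / (2 * R) ^ n"
      by (rule Cauchy_inequality) (use R M hol in \<open>auto intro!: holomorphic_on_imp_continuous_on\<close>)
    then show ?thesis by (simp add: a_def norm_divide field_simps)
  qed
  have M0: "M \<ge> 0" using M[of 0] R norm_ge_zero[of "h 0"] by (simp, linarith)
  have "uniform_limit (cball 0 R) (\<lambda>N z. \<Sum>n<N. a n * z ^ n) (\<lambda>z. \<Sum>n. a n * z ^ n) sequentially"
  proof (rule Weierstrass_m_test)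
    show "norm (a n * z ^ n) \<le> M * (1 / 2) ^ n" if "z \<in> cball 0 R" for n z
    proof -
      have "norm (a n * z ^ n) \<le> M / (2 * R) ^ n * R ^ n"
        unfolding norm_mult norm_power using an that M0 R by (intro mult_mono power_mono) auto
      also have "\<dots> = M * (1 / 2) ^ n" using R by (simp add: power_mult_distrib power_divide)
      finally show ?thesis .
    qed
  qed (auto intro!: summable_mult)
  moreover have "(\<Sum>n. a n * z ^ n) = h z" for z
    using holomorphic_power_series[OF hol, of z 0 "norm z + 1"] unfolding a_def
    by (simp add: sums_iff add_nonneg_pos)
  ultimately have "uniform_limit (cball 0 R) (\<lambda>N z. \<Sum>n<N. a n * z ^ n) h sequentially" by simp
  then have "eventually (\<lambda>N. \<forall>z\<in>cball 0 R. dist (\<Sum>n<N. a n * z ^ n) (h z) < e / 2) sequentially"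
    using e by (intro uniform_limitD) auto
  then obtain N where "\<forall>z\<in>cball 0 R. dist (\<Sum>n<N. a n * z ^ n) (h z) < e / 2"
    using eventually_happens'[OF sequentially_bot] by blast
  then have N: "norm ((\<Sum>n<N. a n * z ^ n) - h z) < e / 2" if "norm z \<le> R" for z
    using that by (simp add: dist_norm)
  \<comment> \<open>The other half of \<open>e\<close> is shared among the coefficient errors.
    Summing up to \<open>N\<close> inclusive keeps the denominator positive even when
    \<open>N = 0\<close>.\<close>
  define \<eta> where "\<eta> = e / 2 / (\<Sum>n\<le>N. R ^ n)"
  have S: "(\<Sum>n\<le>N. R ^ n) > 0" using R by (intro sum_pos) auto
  have \<eta>: "\<eta> > 0" using e S by (simp add: \<eta>_def)
  have "\<exists>d\<in>D. dist (a n) d < \<eta>" for n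
    using D[of "ball (a n) \<eta>"] \<eta> by auto
  then obtain d where d: "\<And>n. d n \<in> D" "\<And>n. dist (a n) (d n) < \<eta>" by metis
  define ds where "ds = map d [0..<N]"
  have "norm (poly (\<Sum>i<length ds. monom (ds ! i) i) z - h z) < e" if z: "norm z \<le> r" for z
  proof -
    have zR: "norm z \<le> R" using z by (simp add: R_def)
    have eq: "poly (\<Sum>i<length ds. monom (ds ! i) i) z = (\<Sum>i<N. d i * z ^ i)"
      by (simp add: ds_def poly_sum poly_monom)
    have "norm ((\<Sum>i<N. d i * z ^ i) - (\<Sum>i<N. a i * z ^ i)) \<le> (\<Sum>i<N. \<eta> * R ^ i)"
      unfolding sum_subtractf[symmetric] left_diff_distrib[symmetric]
    proof (rule sum_norm_le)
      show "norm ((d i - a i) * z ^ i) \<le> \<eta> * R ^ i" for i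
        unfolding norm_mult norm_power using d(2)[of i] zR \<eta>
        by (intro mult_mono power_mono) (auto simp: dist_norm norm_minus_commute)
    qed
    also have "\<dots> \<le> (\<Sum>i\<le>N. \<eta> * R ^ i)" using \<eta> R by (intro sum_mono2) auto
    also have "\<dots> = e / 2" unfolding sum_distrib_left[symmetric] using S by (simp add: \<eta>_def)
    finally show ?thesis using N[OF zR] unfolding eq
      using norm_triangle_ineq[of "(\<Sum>i<N. d i * z ^ i) - (\<Sum>i<N. a i * z ^ i)" "(\<Sum>n<N. a n * z ^ n) - h z"] by simp
  qed
  moreover have "ds \<in> lists D" using d(1) by (auto simp: ds_def)
  ultimately show ?thesis by blast
qed

text \<open>Arbitrarily late indices are demanded because both the radius and the accuracy reached
  by the orbit at step \<open>k\<close> improve with \<open>k\<close>.\<close>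

lemma recurrent_dense_poly_sequence:
  obtains Qs :: "nat \<Rightarrow> complex poly"
  where "\<And>h r e m. h holomorphic_on UNIV \<Longrightarrow> e > 0 \<Longrightarrow>
    \<exists>k\<ge>m. \<forall>z. norm z \<le> r \<longrightarrow> norm (poly (Qs k) z - h z) < e"
proof -
  obtain D :: "complex set" where D: "countable D" "\<And>X. open X \<Longrightarrow> X \<noteq> {} \<Longrightarrow> \<exists>d\<in>D. d \<in> X"
    using countable_dense_exists by metis
  have L: "countable (lists D)" "lists D \<noteq> {}" using D(1) by auto
  \<comment> \<open>Only the first component of the decoded pair selects the polynomial; the second
    makes each one recur infinitely often.\<close>
  define Qs where "Qs = (\<lambda>k. let ds = from_nat_into (lists D) (fst (prod_decode k)) in \<Sum>i<length ds. monom (ds ! i) i)"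
  show ?thesis
  proof (rule that[of Qs])
    fix h :: "complex \<Rightarrow> complex" and r e :: real and m :: nat
    assume "h holomorphic_on UNIV" "e > 0"
    then obtain ds where ds: "ds \<in> lists D"
      "\<And>z. norm z \<le> r \<Longrightarrow> norm (poly (\<Sum>i<length ds. monom (ds ! i) i) z - h z) < e"
      using entire_poly_approximation[OF _ D(2)] by blast
    obtain i where "from_nat_into (lists D) i = ds"
      using from_nat_into_surj[OF L(1) ds(1)] by blast
    then have "Qs (prod_encode (i, m)) = (\<Sum>i<length ds. monom (ds ! i) i)" by (simp add: Qs_def Let_def)
    moreover have "prod_encode (i, m) \<ge> m" by (rule le_prod_encode_2)
    ultimately show "\<exists>k\<ge>m. \<forall>z. norm z \<le> r \<longrightarrow> norm (poly (Qs k) z - h z) < e"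
      using ds(2) by metis
  qed
qed

section \<open>Growth bound and density of the orbit\<close>

theorem theorem1p2:
  fixes \<phi> :: "complex \<Rightarrow> complex" and \<alpha> :: complex and q :: "real \<Rightarrow> real"
  assumes "exponential_type \<phi>"
    and "\<not> \<phi> constant_on UNIV"
    and "norm (\<phi> \<alpha>) = 1"
    and "deriv \<phi> \<alpha> \<noteq> 0"
    and "\<And>r. r \<ge> 0 \<Longrightarrow> q r \<ge> 1"
    and "filterlim q at_top at_top"
  shows "\<exists>f\<^sub>0 \<in> entire. max_modulus f\<^sub>0 \<in> O[at_top](\<lambda>r. r powr q r) \<and>
           (\<lambda>z. f\<^sub>0 z * exp_fun \<alpha> z) \<in> hypercyclic_vectors (diff_op \<phi>) entire_topology"
proof -
  define c where "c = (\<lambda>n. (deriv ^^ n) \<phi> 0 / fact n)"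
  have T: "diff_op \<phi> = coeff_op c" by (rule ext) (simp add: diff_op_def coeff_op_def c_def)
  obtain C A where c: "exp_bounded C A c"
    using exponential_type_coeffs[OF assms(1)] unfolding c_def by blast
  have \<phi>: "\<phi> holomorphic_on UNIV" using assms(1) by (simp add: exponential_type_def entire_def)
  have \<kappa>: "\<phi> \<alpha> = (\<Sum>n. c n * \<alpha> ^ n)" and \<mu>: "deriv \<phi> \<alpha> = (\<Sum>n. of_nat (Suc n) * c (Suc n) * \<alpha> ^ n)"
    unfolding c_def by (rule diff_op_symbol_values[OF \<phi>, symmetric])+
  have "\<phi> \<alpha> \<noteq> 0" using assms(3) by auto
  then obtain b where b: "\<And>j. degree (b j) = j" "\<And>j. b j \<noteq> 0"
    "coeff_op c (weighted_poly \<alpha> (b 0)) = weighted_poly \<alpha> (smult (\<phi> \<alpha>) (b 0))"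
    "\<And>j. coeff_op c (weighted_poly \<alpha> (b (Suc j))) = weighted_poly \<alpha> (smult (\<phi> \<alpha>) (b (Suc j) + b j))"
    using triangular_basis_exists[OF c \<kappa> _ \<mu> assms(4)] by metis
  obtain Qs :: "nat \<Rightarrow> complex poly" where Qs: "\<And>h r e m. h holomorphic_on UNIV \<Longrightarrow> e > 0 \<Longrightarrow>
    \<exists>k\<ge>m. \<forall>z. norm z \<le> r \<longrightarrow> norm (poly (Qs k) z - h z) < e"
    using recurrent_dense_poly_sequence by blast
  obtain f where f: "f holomorphic_on UNIV" "\<And>z. norm (f z) \<le> 2 * max 1 (norm z powr q (norm z))"
    and orbit: "\<And>k. \<exists>n. \<forall>z. norm z \<le> real k \<longrightarrow>
      norm ((coeff_op c ^^ n) (\<lambda>z. f z * exp_fun \<alpha> z) z - weighted_poly \<alpha> (Qs k) z) \<le> 2 * (1 / 2) ^ k"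
    using slow_growth_approximating_orbit[where b = b and Qs = Qs, OF c b assms(3) poly_growth[OF assms(6)]
        order_trans[OF zero_le_one max.cobounded1]] by blast
  have ent: "f \<in> entire" using f(1) by (simp add: entire_def)
  have "max_modulus f \<in> O[at_top](\<lambda>r. r powr q r)"
  proof (rule bigoI)
    show "eventually (\<lambda>r. norm (max_modulus f r) \<le> 2 * norm (r powr q r)) at_top"
      using eventually_ge_at_top[of 1]
    proof eventually_elim
      case (elim r)
      obtain z where z: "norm z = r" "max_modulus f r = norm (f z)"
        using max_modulus_attained(1)[OF ent, of r] elim by auto
      \<comment> \<open>Hence the maximum with 1 in the growth bound disappears for
        \<open>r \<ge> 1\<close>.\<close>
      have "r powr q r \<ge> 1" using elim assms(5)[of r] by (intro ge_one_powr_ge_zero) auto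
      then show ?case using f(2)[of z] z by simp
    qed
  qed
  moreover have "(\<lambda>z. f z * exp_fun \<alpha> z) \<in> hypercyclic_vectors (diff_op \<phi>) entire_topology"
  proof -
    define F where "F = (\<lambda>z. f z * exp_fun \<alpha> z)"
    have F: "F holomorphic_on UNIV" unfolding F_def by (intro holomorphic_intros f(1))
    have "g \<in> entire_topology closure_of {(coeff_op c ^^ n) F | n. True}" if g: "g \<in> entire" for g
      unfolding in_closure_of
    proof (intro conjI allI impI)
      fix U assume U: "g \<in> U \<and> openin entire_topology U"
      then obtain K e where K: "compact K" "e > 0" "{h \<in> entire. \<forall>z\<in>K. dist (h z) (g z) < e} \<subseteq> U"
        unfolding openin_entire_topology by blast
      obtain R where R: "R > 0" "\<And>z. z \<in> K \<Longrightarrow> norm z \<le> R"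
        using compact_imp_bounded[OF K(1)] bounded_pos by metis
      obtain E where E: "E > 0" "\<And>z. norm z \<le> R \<Longrightarrow> norm (exp_fun \<alpha> z) \<le> E"
        using entire_bounded_on_cball[OF exp_fun_holomorphic] by metis
      obtain m1 :: nat where m1: "R \<le> real m1" using real_arch_simple by blast
      \<comment> \<open>A quarter, because the orbit error at step \<open>k\<close> is
        \<open>2 * (1/2)^k\<close> and should stay below \<open>e / 2\<close>.\<close>
      obtain m2 where m2: "(1 / 2 :: real) ^ m2 < e / 4"
        using real_arch_pow_inv[of "e / 4" "1 / 2"] K(2) by auto
      \<comment> \<open>The polynomial is chosen close to \<open>g\<close> times the inverse
        exponential; multiplying back by the exponential, which is at most \<open>E\<close> on the
        disc, costs the factor \<open>E\<close> in the tolerance.\<close>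
      have "(\<lambda>z. g z * exp_fun (- \<alpha>) z) holomorphic_on UNIV"
        using g by (auto simp: entire_def intro!: holomorphic_intros)
      then obtain k where k: "k \<ge> max m1 m2"
        "\<And>z. norm z \<le> R \<Longrightarrow> norm (poly (Qs k) z - g z * exp_fun (- \<alpha>) z) < e / 2 / E"
        using Qs[of "\<lambda>z. g z * exp_fun (- \<alpha>) z" "e / 2 / E"] K(2) E(1) by fastforce
      obtain n where n: "\<And>z. norm z \<le> real k \<Longrightarrow>
          norm ((coeff_op c ^^ n) F z - weighted_poly \<alpha> (Qs k) z) \<le> 2 * (1 / 2) ^ k"
        using orbit[of k] unfolding F_def by blast
      have "dist ((coeff_op c ^^ n) F z) (g z) < e" if "z \<in> K" for z
      proof -
        have z: "norm z \<le> R" "norm z \<le> real k" using R(2)[OF that] m1 k(1) by auto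
        have "(1 / 2 :: real) ^ k \<le> (1 / 2) ^ m2" using k(1) by (intro power_decreasing) auto
        then have 1: "norm ((coeff_op c ^^ n) F z - weighted_poly \<alpha> (Qs k) z) < e / 2"
          using n[OF z(2)] m2 by linarith
        have "weighted_poly \<alpha> (Qs k) z - g z = (poly (Qs k) z - g z * exp_fun (- \<alpha>) z) * exp_fun \<alpha> z"
          by (simp add: weighted_poly_def exp_fun_def left_diff_distrib mult.assoc flip: exp_add)
        then have "norm (weighted_poly \<alpha> (Qs k) z - g z) \<le> (e / 2 / E) * E"
          using k(2)[OF z(1)] E z(1) K(2) unfolding norm_mult
          by (simp only: norm_mult) (intro mult_mono, auto)
        then have "norm (weighted_poly \<alpha> (Qs k) z - g z) \<le> e / 2" using E(1) by simp
        then show ?thesis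
          using 1 norm_triangle_ineq[of "(coeff_op c ^^ n) F z - weighted_poly \<alpha> (Qs k) z" "weighted_poly \<alpha> (Qs k) z - g z"]
          by (simp add: dist_norm)
      qed
      moreover have "(coeff_op c ^^ n) F \<in> entire"
        using coeff_op_funpow_holomorphic[OF c F] by (simp add: entire_def)
      ultimately show "\<exists>h. h \<in> {(coeff_op c ^^ n) F | n. True} \<and> h \<in> U" using K(3) by blast
    qed (use g in simp)
    then have "entire_topology closure_of {(coeff_op c ^^ n) F | n. True} = entire"
      using closure_of_subset_topspace[of entire_topology] by auto
    moreover have "F \<in> entire" using F by (simp add: entire_def)
    ultimately show ?thesis
      unfolding hypercyclic_vectors_def T F_def by simp
  qed
  ultimately show ?thesis using ent by blast
qed

end
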